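(* Suppose that assumptions (a)-(e) of the context hold. Let the sequence $\{y^t,x^t,\mu^t\}$ be generated by the stochastic Bregman parallel direction method of multipliers (stochastic BPDMM) described in the context, and let $R(t+1)$ and $V(t)$ be the residual and the Lyapunov function defined in the context. If $\rho,\tau,\gamma,\omega$ satisfy $$\tau\le \frac{\rho(\omega\alpha\sigma-\gamma)}{2-\omega},\qquad 0<\gamma<\omega\alpha\sigma,$$ where $\sigma=\min\{1,n^{\frac{2}{p}-1}\}$ and $\alpha$, $p$ are as in assumption (c), then the following monotonicity relation holds: $$\mathbb{E}_{\mathcal{S}_{1:t}}[V(t)]-\mathbb{E}_{\mathcal{S}_{1:t+1}}[V(t+1)]\ \ge\ \mathbb{E}_{\mathcal{S}_{1:t+1}}[R(t+1)].$$
   Context: **Graph and matrix.** $\mathcal{G}=(\mathcal{V},\mathcal{E})$ is an undirected connected graph with vertex set $\mathcal{V}=\{1,2,\dots,m\}$ and edge set $\mathcal{E}\subseteq\mathcal{V}\times\mathcal{V}$ such that $(i,j)\in\mathcal{E}$ if and only if $(j,i)\in\mathcal{E}$; $\mathcal{N}(i)$ is the set of neighbors of node $i$, with $j\in\mathcal{N}(i)$ if $(i,j)\in\mathcal{E}$. $P\in\mathbb{R}^{|\mathcal{V}|\times|\mathcal{V}|}$ is a matrix defined on $\mathcal{G}$ in the sense that $P_{ij}>0$ implies $j\in\mathcal{N}(i)$. Put $Q=I_{|\mathcal{V}|}-P$. Vectors $x\in\mathbb{R}^{|\mathcal{V}|n}$ are written in blocks $x=[x_1^\top,\dots,x_{|\mathcal{V}|}^\top]^\top$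 with $x_i\in\mathbb{R}^n$, and similarly for $\mu$ and $y$. $\otimes$ is the Kronecker product and $\langle\cdot,\cdot\rangle$ the dot product. **Subgradients.** $\partial f(u)$ is the set of $g\in\mathbb{R}^n$ with $f(v)-f(u)\ge\langle g,v-u\rangle$ for all $v\in\mathbb{R}^n$. The indicator function $\delta_{\mathcal{X}}$ of a convex set $\mathcal{X}$ is $0$ on $\mathcal{X}$ and $+\infty$ elsewhere. **Mirror map and Bregman divergence.** For a convex open set $\mathcal{D}\subseteq\mathbb{R}^n$, $\phi:\mathcal{D}\to\mathbb{R}$ is a mirror map if it is differentiable and strictly convex, $\nabla\phi$ takes all possible values, and $\nabla\phi$ diverges on the boundary of the closure of $\mathcal{D}$, i.e. $\lim_{u\to\partial\overline{\mathcal{D}}}\|\nabla\phi(u)\|=\infty$ (for an arbitrary norm on $\mathbb{R}^n$). The Bregman divergence is $B_\phi(u,v)=\phi(u)-\phi(v)-\langle\nabla\phi(v),u-v\rangle$. **Assumptions.** (a) $f_i:\mathbb{R}^n\to\mathbb{R}\cup\{+\infty\}$ is closed, proper and convex for all $i\in\mathcal{V}$. (b) $\mathcal{X}\subset\mathbb{R}^n$ is closed and convex. There exists a saddle point $(x^\star,\mu^\star)$ such that, for all $i\in\mathcal{V}$, $x_i^\star\in\mathcal{X}$, $\sum_{j\in\mathcal{V}}P_{ij}x_j^\star=x_i^\star$ and $-\mu_i^\star+\sum_{j\in\mathcal{V}}P_{ij}\mu_j^\star\in\partial(f_i+\delta_\mathcal{X})(x_i^\star)$. (c) $\phi:\mathcal{D}\to\mathbb{R}$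 is a mirror map, where $\mathcal{D}$ is an open convex set such that $\mathcal{X}$ is included in its closure. In addition, $\phi$ is $\alpha$-strongly convex with respect to the $l_p$-norm, i.e. $B_\phi(u,v)\ge\frac{\alpha}{2}\|u-v\|_p^2$ for any $u,v\in\mathcal{X}$. (d) $P$ is symmetric, stochastic, irreducible and positive semi-definite. (e) At each iteration $t+1$, $|\mathcal{S}_{t+1}|/|\mathcal{V}|=\omega$ with $0<\omega<1$, where $\mathcal{S}_{t+1}$ is the randomly selected set of nodes in the algorithm below. **Stochastic BPDMM.** Parameters $\tau,\rho>0$; initial point $x^0\in(\mathcal{X}\cap\mathcal{D})^{|\mathcal{V}|}$, $\mu^0\in\mathbb{R}^{|\mathcal{V}|n}$. For $t=0,1,2,\dots$, randomly select a subset of nodes $\mathcal{S}_{t+1}\subset\mathcal{V}$ and set - for all $i\in\mathcal{S}_{t+1}$: $y_i^t=\mathrm{argmin}_{y_i\in\mathcal{X}}\sum_{j\in\mathcal{N}(i)}P_{ij}B_\phi(y_i,x_j^t)$; - for all $i\in\mathcal{S}_{t+1}$: $x_i^{t+1}=\mathrm{argmin}_{x_i\in\mathcal{X}}\ f_i(x_i)+\langle x_i,\mu_i^t-\sum_{j\in\mathcal{N}(i)}P_{ij}\mu_j^t\rangle+\rho B_\phi(x_i,y_i^t)$; - for all $i\in\mathcal{V}\setminus\mathcal{S}_{t+1}$: $x_i^{t+1}=x_i^t$; - for all $i\in\mathcal{V}$: $\mu_i^{t+1}=\mu_i^t+\tau x_i^{t+1}-\tau\sum_{j\in\mathcal{N}(i)}P_{ij}x_j^{t+1}$.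 $\mathcal{S}_{1:t}$ denotes the history of selected node sets $\{\mathcal{S}_1,\dots,\mathcal{S}_t\}$, and $\mathbb{E}_{\mathcal{S}_{1:t}}$ the expectation over the realization of $\mathcal{S}_{1:t}$. **Definitions.** With $\gamma>0$, $$L(x,\mu)=\sum_{i\in\mathcal{V}}(f_i+\delta_\mathcal{X})(x_i)+\langle\mu,(Q\otimes I_n)x\rangle,$$ $$R(t+1)=\omega\big(L(x^t,\mu^\star)-L(x^\star,\mu^\star)\big)+\rho\sum_{i\in\mathcal{S}_{t+1}}B_\phi(x_i^{t+1},y_i^t)+\frac{\gamma\rho}{2}\|(Q\otimes I_n)x^t\|_2^2,$$ $$H(x^t,\mu^t)=L(x^t,\mu^t)-L(x^\star,\mu^\star)-\tau\|(Q\otimes I_n)x^t\|_2^2,$$ $$V(t)=H(x^t,\mu^t)+\frac{\omega}{2\tau}\|\mu^\star-\mu^{t-1}\|_2^2+\rho\sum_{i\in\mathcal{V}}B_\phi(x_i^\star,x_i^t),$$ with $\mu^{-1}:=\mu^0-\tau(Q\otimes I_n)x^0$. *)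

theory Defs
  imports "HOL-Probability.Probability"
begin

section \<open>Convex analysis\<close>

definition ereal_epigraph :: "('a \<Rightarrow> ereal) \<Rightarrow> ('a \<times> real) set" where
  "ereal_epigraph f = {(u, r). f u \<le> ereal r}"

definition closed_proper_convex :: "('a::euclidean_space \<Rightarrow> ereal) \<Rightarrow> bool" where
  "closed_proper_convex f \<longleftrightarrow>
     closed (ereal_epigraph f) \<and> convex (ereal_epigraph f) \<and>
     (\<forall>u. f u \<noteq> -\<infinity>) \<and> (\<exists>u. f u \<noteq> \<infinity>)"

definition convex_indicator :: "'a set \<Rightarrow> 'a \<Rightarrow> ereal" where
  "convex_indicator X u = (if u \<in> X then 0 else \<infinity>)"

text \<open>The difference \<open>f v - f u\<close> is only meaningful for all \<open>v\<close> when \<open>f u\<close> is finite, so the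
  subdifferential is empty outside the effective domain.\<close>

definition subdifferential :: "('a::real_inner \<Rightarrow> ereal) \<Rightarrow> 'a \<Rightarrow> 'a set" where
  "subdifferential f u = {g. \<bar>f u\<bar> \<noteq> \<infinity> \<and> (\<forall>v. f v - f u \<ge> ereal (g \<bullet> (v - u)))}"

definition strictly_convex_on :: "'a::real_vector set \<Rightarrow> ('a \<Rightarrow> real) \<Rightarrow> bool" where
  "strictly_convex_on D \<phi> \<longleftrightarrow> convex D \<and>
     (\<forall>u\<in>D. \<forall>v\<in>D. \<forall>s. u \<noteq> v \<longrightarrow> 0 < s \<longrightarrow> s < 1 \<longrightarrow>
        \<phi> ((1 - s) *\<^sub>R u + s *\<^sub>R v) < (1 - s) * \<phi> u + s * \<phi> v)"

definition gradient :: "('a::euclidean_space \<Rightarrow> real) \<Rightarrow> 'a \<Rightarrow> 'a" where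
  "gradient \<phi> u = (THE g. GDERIV \<phi> u :> g)"

text \<open>Only the values of \<open>\<phi>\<close> on the open set \<open>D\<close> matter in the next definition.\<close>

definition mirror_map :: "'a::euclidean_space set \<Rightarrow> ('a \<Rightarrow> real) \<Rightarrow> bool" where
  "mirror_map D \<phi> \<longleftrightarrow>
     (\<forall>u\<in>D. \<phi> differentiable (at u)) \<and>
     strictly_convex_on D \<phi> \<and>
     gradient \<phi> ` D = UNIV \<and>
     (\<forall>z \<in> frontier (closure D). filterlim (\<lambda>u. norm (gradient \<phi> u)) at_top (at z within D))"

text \<open>\<open>X\<close> is only contained in the closure of \<open>D\<close>, so the first argument of the Bregman divergence
  may lie on the boundary of \<open>D\<close> (as for the Kullback-Leibler divergence on the simplex). There
  \<open>\<phi>\<close> is extended by its lower limit; off the closure of \<open>D\<close> the filter is trivial and the value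
  is \<open>\<infinity>\<close>.\<close>

definition lsc_extension :: "'a::euclidean_space set \<Rightarrow> ('a \<Rightarrow> real) \<Rightarrow> 'a \<Rightarrow> ereal" where
  "lsc_extension D \<phi> u =
     (if u \<in> D then ereal (\<phi> u) else Liminf (at u within D) (\<lambda>v. ereal (\<phi> v)))"

text \<open>The second argument must lie in \<open>D\<close> for the gradient to exist; the value is \<open>\<infinity>\<close> otherwise.\<close>

definition bregman :: "'a::euclidean_space set \<Rightarrow> ('a \<Rightarrow> real) \<Rightarrow> 'a \<Rightarrow> 'a \<Rightarrow> ereal" where
  "bregman D \<phi> u v =
     (if v \<in> D then lsc_extension D \<phi> u - ereal (\<phi> v) - ereal (gradient \<phi> v \<bullet> (u - v)) else \<infinity>)"

definition lp_norm :: "ereal \<Rightarrow> real ^ 'n \<Rightarrow> real" where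
  "lp_norm p v =
     (if p = \<infinity> then infnorm v
      else (\<Sum>k\<in>UNIV. \<bar>v $ k\<bar> powr real_of_ereal p) powr (1 / real_of_ereal p))"


section \<open>Graphs and matrices\<close>

definition undirected_connected_graph :: "('v \<times> 'v) set \<Rightarrow> bool" where
  "undirected_connected_graph E \<longleftrightarrow> sym E \<and> E\<^sup>* = UNIV"

definition neighbors :: "('v \<times> 'v) set \<Rightarrow> 'v \<Rightarrow> 'v set" where
  "neighbors E i = {j. (i, j) \<in> E}"

definition defined_on_graph :: "('v \<times> 'v) set \<Rightarrow> real ^ 'v ^ 'v \<Rightarrow> bool" where
  "defined_on_graph E P \<longleftrightarrow> (\<forall>i j. P $ i $ j > 0 \<longrightarrow> j \<in> neighbors E i)"

definition stochastic_matrix :: "real ^ 'v ^ 'v \<Rightarrow> bool" where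
  "stochastic_matrix P \<longleftrightarrow> (\<forall>i j. P $ i $ j \<ge> 0) \<and> (\<forall>i. (\<Sum>j\<in>UNIV. P $ i $ j) = 1)"

definition matrix_power :: "real ^ 'v ^ 'v \<Rightarrow> nat \<Rightarrow> real ^ 'v ^ 'v" where
  "matrix_power P k = (((**) P) ^^ k) (mat 1)"

definition irreducible_matrix :: "real ^ 'v ^ 'v \<Rightarrow> bool" where
  "irreducible_matrix P \<longleftrightarrow> (\<forall>i j. \<exists>k. matrix_power P k $ i $ j > 0)"

definition positive_semidefinite :: "real ^ 'v ^ 'v \<Rightarrow> bool" where
  "positive_semidefinite P \<longleftrightarrow> (\<forall>v. v \<bullet> (P *v v) \<ge> 0)"

definition kronecker ::
  "real ^ 'b ^ 'a \<Rightarrow> real ^ 'd ^ 'c \<Rightarrow>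
   real ^ ('b::finite \<times> 'd::finite) ^ ('a::finite \<times> 'c::finite)" where
  "kronecker A B = (\<chi> p q. A $ fst p $ fst q * B $ snd p $ snd q)"

text \<open>The stacked vector with blocks \<open>x i\<close>; its coordinates are indexed by block and position.\<close>

definition stack :: "('v::finite \<Rightarrow> real ^ 'n) \<Rightarrow> real ^ ('v \<times> 'n)" where
  "stack x = (\<chi> p. x (fst p) $ snd p)"

text \<open>The matrix \<open>Q \<otimes> I\<close> with \<open>Q = I - P\<close>.\<close>

definition QI :: "real ^ 'v ^ 'v \<Rightarrow> real ^ ('v::finite \<times> 'n::finite) ^ ('v \<times> 'n)" where
  "QI P = kronecker (mat 1 - P) (mat 1)"


section \<open>Stochastic BPDMM\<close>

text \<open>One realization of the algorithm: \<open>S t\<close> (for \<open>t \<ge> 1\<close>) are the selected node sets. The block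
  \<open>y t i\<close> is computed, and constrained, only for \<open>i \<in> S (Suc t)\<close>.\<close>

definition bpdmm_run ::
  "('v::finite \<times> 'v) set \<Rightarrow> real ^ 'v ^ 'v \<Rightarrow> ('v \<Rightarrow> real ^ 'n \<Rightarrow> ereal) \<Rightarrow> (real ^ 'n) set \<Rightarrow>
   (real ^ 'n) set \<Rightarrow> (real ^ 'n \<Rightarrow> real) \<Rightarrow> real \<Rightarrow> real \<Rightarrow>
   ('v \<Rightarrow> real ^ 'n) \<Rightarrow> ('v \<Rightarrow> real ^ 'n) \<Rightarrow> (nat \<Rightarrow> 'v set) \<Rightarrow>
   (nat \<Rightarrow> 'v \<Rightarrow> real ^ 'n) \<Rightarrow> (nat \<Rightarrow> 'v \<Rightarrow> real ^ 'n) \<Rightarrow> (nat \<Rightarrow> 'v \<Rightarrow> real ^ 'n) \<Rightarrow> bool" where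
  "bpdmm_run E P f X D \<phi> \<tau> \<rho> x0 \<mu>0 S x y \<mu> \<longleftrightarrow>
     x 0 = x0 \<and> \<mu> 0 = \<mu>0 \<and>
     (\<forall>t.
        (\<forall>i \<in> S (Suc t).
           is_arg_min (\<lambda>u. \<Sum>j\<in>neighbors E i. ereal (P $ i $ j) * bregman D \<phi> u (x t j))
             (\<lambda>u. u \<in> X) (y t i)) \<and>
        (\<forall>i \<in> S (Suc t).
           is_arg_min
             (\<lambda>u. f i u + ereal (u \<bullet> (\<mu> t i - (\<Sum>j\<in>neighbors E i. P $ i $ j *\<^sub>R \<mu> t j)))
                  + ereal \<rho> * bregman D \<phi> u (y t i))
             (\<lambda>u. u \<in> X) (x (Suc t) i)) \<and>
        (\<forall>i \<in> - S (Suc t). x (Suc t) i = x t i) \<and>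
        (\<forall>i. \<mu> (Suc t) i =
               \<mu> t i + \<tau> *\<^sub>R x (Suc t) i - \<tau> *\<^sub>R (\<Sum>j\<in>neighbors E i. P $ i $ j *\<^sub>R x (Suc t) j)))"

definition lagrangian ::
  "real ^ 'v ^ 'v \<Rightarrow> ('v::finite \<Rightarrow> real ^ 'n \<Rightarrow> ereal) \<Rightarrow> (real ^ 'n) set \<Rightarrow>
   ('v \<Rightarrow> real ^ 'n) \<Rightarrow> ('v \<Rightarrow> real ^ 'n) \<Rightarrow> ereal" where
  "lagrangian P f X x \<mu> =
     (\<Sum>i\<in>UNIV. f i (x i) + convex_indicator X (x i)) + ereal (stack \<mu> \<bullet> (QI P *v stack x))"

text \<open>\<open>residual \<dots> S x y t\<close> is the quantity \<open>R(t + 1)\<close>.\<close>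

definition residual ::
  "real ^ 'v ^ 'v \<Rightarrow> ('v::finite \<Rightarrow> real ^ 'n \<Rightarrow> ereal) \<Rightarrow> (real ^ 'n) set \<Rightarrow>
   (real ^ 'n) set \<Rightarrow> (real ^ 'n \<Rightarrow> real) \<Rightarrow> real \<Rightarrow> real \<Rightarrow> real \<Rightarrow>
   ('v \<Rightarrow> real ^ 'n) \<Rightarrow> ('v \<Rightarrow> real ^ 'n) \<Rightarrow> (nat \<Rightarrow> 'v set) \<Rightarrow>
   (nat \<Rightarrow> 'v \<Rightarrow> real ^ 'n) \<Rightarrow> (nat \<Rightarrow> 'v \<Rightarrow> real ^ 'n) \<Rightarrow> nat \<Rightarrow> ereal" where
  "residual P f X D \<phi> \<rho> \<gamma> \<omega> xstar \<mu>star S x y t =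
     ereal \<omega> * (lagrangian P f X (x t) \<mu>star - lagrangian P f X xstar \<mu>star)
     + ereal \<rho> * (\<Sum>i\<in>S (Suc t). bregman D \<phi> (x (Suc t) i) (y t i))
     + ereal (\<gamma> * \<rho> / 2 * (norm (QI P *v stack (x t)))\<^sup>2)"

definition H_fun ::
  "real ^ 'v ^ 'v \<Rightarrow> ('v::finite \<Rightarrow> real ^ 'n \<Rightarrow> ereal) \<Rightarrow> (real ^ 'n) set \<Rightarrow> real \<Rightarrow>
   ('v \<Rightarrow> real ^ 'n) \<Rightarrow> ('v \<Rightarrow> real ^ 'n) \<Rightarrow> ('v \<Rightarrow> real ^ 'n) \<Rightarrow> ('v \<Rightarrow> real ^ 'n) \<Rightarrow> ereal" where
  "H_fun P f X \<tau> xstar \<mu>star x \<mu> =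
     lagrangian P f X x \<mu> - lagrangian P f X xstar \<mu>star
     - ereal (\<tau> * (norm (QI P *v stack x))\<^sup>2)"

definition previous_multiplier ::
  "real ^ 'v ^ 'v \<Rightarrow> real \<Rightarrow> (nat \<Rightarrow> 'v::finite \<Rightarrow> real ^ 'n) \<Rightarrow> (nat \<Rightarrow> 'v \<Rightarrow> real ^ 'n) \<Rightarrow> nat \<Rightarrow>
   real ^ ('v \<times> 'n)" where
  "previous_multiplier P \<tau> x \<mu> t =
     (case t of 0 \<Rightarrow> stack (\<mu> 0) - \<tau> *\<^sub>R (QI P *v stack (x 0)) | Suc s \<Rightarrow> stack (\<mu> s))"

definition lyapunov ::
  "real ^ 'v ^ 'v \<Rightarrow> ('v::finite \<Rightarrow> real ^ 'n \<Rightarrow> ereal) \<Rightarrow> (real ^ 'n) set \<Rightarrow>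
   (real ^ 'n) set \<Rightarrow> (real ^ 'n \<Rightarrow> real) \<Rightarrow> real \<Rightarrow> real \<Rightarrow> real \<Rightarrow>
   ('v \<Rightarrow> real ^ 'n) \<Rightarrow> ('v \<Rightarrow> real ^ 'n) \<Rightarrow>
   (nat \<Rightarrow> 'v \<Rightarrow> real ^ 'n) \<Rightarrow> (nat \<Rightarrow> 'v \<Rightarrow> real ^ 'n) \<Rightarrow> nat \<Rightarrow> ereal" where
  "lyapunov P f X D \<phi> \<tau> \<rho> \<omega> xstar \<mu>star x \<mu> t =
     H_fun P f X \<tau> xstar \<mu>star (x t) (\<mu> t)
     + ereal (\<omega> / (2 * \<tau>) * (norm (stack \<mu>star - previous_multiplier P \<tau> x \<mu> t))\<^sup>2)
     + ereal \<rho> * (\<Sum>i\<in>UNIV. bregman D \<phi> (xstar i) (x t i))"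


section \<open>Random node selection and expectation\<close>

text \<open>The selected sets \<open>S 1, S 2, \<dots>\<close> are independent and uniformly distributed on the sets of
  nodes of relative size \<open>\<omega>\<close>.\<close>

definition random_node_selection ::
  "'w measure \<Rightarrow> real \<Rightarrow> (nat \<Rightarrow> 'w \<Rightarrow> 'v::finite set) \<Rightarrow> bool" where
  "random_node_selection M \<omega> S \<longleftrightarrow>
     (\<forall>t\<ge>1. \<forall>w\<in>space M. real (card (S t w)) / real CARD('v) = \<omega>) \<and>
     prob_space.indep_vars M (\<lambda>_. count_space UNIV) S {1..} \<and>
     (\<forall>t\<ge>1. distr M (count_space UNIV) (S t) =
        measure_pmf (pmf_of_set {A. real (card A) / real CARD('v) = \<omega>}))"

text \<open>Expectation of an extended-real random variable, as the integral of the positive part minus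
  the integral of the negative part (\<open>e2ennreal\<close> sends negative numbers to \<open>0\<close>).\<close>

definition ereal_expectation :: "'w measure \<Rightarrow> ('w \<Rightarrow> ereal) \<Rightarrow> ereal" where
  "ereal_expectation M Z =
     enn2ereal (\<integral>\<^sup>+w. e2ennreal (Z w) \<partial>M) - enn2ereal (\<integral>\<^sup>+w. e2ennreal (- Z w) \<partial>M)"

lemma ereal_expectation_eq_integral:
  assumes "integrable M Z"
  shows "ereal_expectation M (\<lambda>w. ereal (Z w)) = ereal (integral\<^sup>L M Z)"
proof -
  have fin: "(\<integral>\<^sup>+w. ennreal (Z w) \<partial>M) \<noteq> \<infinity>" "(\<integral>\<^sup>+w. ennreal (- Z w) \<partial>M) \<noteq> \<infinity>"
    using assms by (auto simp: real_integrable_def)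
  have *: "enn2ereal a - enn2ereal b = ereal (enn2real a - enn2real b)"
    if "a \<noteq> \<infinity>" "b \<noteq> \<infinity>" for a b
    using that by (cases a; cases b) (auto simp: enn2ereal_ennreal)
  show ?thesis
    unfolding ereal_expectation_def real_lebesgue_integral_def[OF assms]
    using *[OF fin] by (simp add: ennreal.abs_eq[symmetric] e2ennreal_ereal)
qed

end

(* Comparing the optimality inequalities of the two argmin steps at the saddle point and averaging over
   the uniformly chosen node set cancels the Bregman distances to the (consensual) saddle point and
   leaves the surplus omega rho sum_ij P_ij B(y_i, x_j). By strong convexity it dominates a multiple of
   sum_ij P_ij |y_i - x_j|^2 >= |(Q \<otimes> I) x|^2, which pays for the dual ascent step.
   The optimality inequalities need y_i and x_i to lie in D, where phi is differentiable. This follows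
   from the blow-up of the gradient at the frontier, provided every f_i is finite somewhere on X \<inter> D;
   otherwise V(t) is identically infinite and so is the left-hand side, as \<infinity> - \<infinity> = \<infinity> in ereal. In the
   former case the minimizers are also unique, hence the iterates depend on the selection history only,
   and every expectation is a finite average over equally likely histories. *)

theory Submission
  imports Defs
begin

section \<open>Mirror maps and composite minimization\<close>

text \<open>A run computes updates only at the selected nodes, while the average over selections
  involves the update that every node would make from the same past. As each block depends on the
  old iterates alone, this virtual update is assembled from several outcomes with equal past, for
  each node one that selects it. Averaging needs the new Lyapunov value to be separable over the
  nodes. This explains the form of V: the subtracted multiple of |(Q \<otimes> I) x|^2 cancels what
  the dual step adds to the Lagrangian, and the multiplier in the quadratic term lags by one step,
  hence is fixed before the set is drawn. The iterates are arbitrary functions of the outcome with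
  no measurability given; reducing them to finitely many histories is what makes their expectations
  computable.\<close>

lemma GDERIV_gradient:
  assumes "\<phi> differentiable (at u)"
  shows "GDERIV \<phi> u :> gradient \<phi> u"
proof -
  obtain \<phi>' where d: "(\<phi> has_derivative \<phi>') (at u)"
    using assms by (auto simp: differentiable_def)
  have lin: "linear \<phi>'"
    using d has_derivative_linear by blast
  define g where "g = (\<Sum>b\<in>Basis. \<phi>' b *\<^sub>R b)"
  have "\<phi>' h = h \<bullet> g" for h
  proof -
    have "\<phi>' h = \<phi>' (\<Sum>b\<in>Basis. (h \<bullet> b) *\<^sub>R b)"
      by (simp add: euclidean_representation)
    also have "\<dots> = (\<Sum>b\<in>Basis. (h \<bullet> b) * \<phi>' b)"
      by (simp add: linear_sum[OF lin] linear_cmul[OF lin])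
    also have "\<dots> = h \<bullet> g"
      by (simp add: g_def inner_sum_right mult.commute)
    finally show ?thesis .
  qed
  then have "\<phi>' = (\<lambda>h. h \<bullet> g)" by auto
  then have g: "GDERIV \<phi> u :> g"
    using d by (simp add: gderiv_def)
  moreover have "g' = g" if "GDERIV \<phi> u :> g'" for g'
  proof -
    have "(\<lambda>h. h \<bullet> g') = (\<lambda>h. h \<bullet> g)"
      using that g has_derivative_unique unfolding gderiv_def by blast
    then have "\<forall>h. h \<bullet> g' = h \<bullet> g" by (auto dest: fun_cong)
    then show ?thesis by (simp only: vector_eq_ldot)
  qed
  ultimately show ?thesis
    unfolding gradient_def by (rule theI)
qed

text \<open>One-sided, because the points compared with \<open>u\<close> are reached along segments
  that start at \<open>u\<close> and stay in a convex set.\<close>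

lemma gradient_directional_limit:
  assumes "\<phi> differentiable (at u)"
  shows "((\<lambda>s. (\<phi> (u + s *\<^sub>R h) - \<phi> u) / s) \<longlongrightarrow> gradient \<phi> u \<bullet> h) (at_right 0)"
proof -
  have 1: "(\<phi> has_derivative (\<lambda>k. k \<bullet> gradient \<phi> u)) (at (u + 0 *\<^sub>R h))"
    using GDERIV_gradient[OF assms] by (simp add: gderiv_def)
  have 2: "((\<lambda>s. u + s *\<^sub>R h) has_derivative (\<lambda>s. s *\<^sub>R h)) (at 0)"
    by (auto intro!: derivative_eq_intros)
  have "((\<lambda>s. \<phi> (u + s *\<^sub>R h)) has_real_derivative gradient \<phi> u \<bullet> h) (at 0)"
    using has_derivative_compose[OF 2 1]
    by (simp add: has_field_derivative_def inner_commute mult.commute[of _ "_ \<bullet> _"])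
  then have "((\<lambda>s. (\<phi> (u + s *\<^sub>R h) - \<phi> u) / s) \<longlongrightarrow> gradient \<phi> u \<bullet> h) (at 0)"
    by (simp add: DERIV_def)
  then show ?thesis
    by (simp add: filterlim_at_split)
qed

lemma gradient_inequality:
  assumes "convex_on D \<phi>" "u \<in> D" "v \<in> D" "\<phi> differentiable (at u)"
  shows "\<phi> u + gradient \<phi> u \<bullet> (v - u) \<le> \<phi> v"
proof -
  have "(\<phi> (u + s *\<^sub>R (v - u)) - \<phi> u) / s \<le> \<phi> v - \<phi> u" if "0 < s" "s < 1" for s
  proof -
    have "\<phi> ((1 - s) *\<^sub>R u + s *\<^sub>R v) \<le> (1 - s) * \<phi> u + s * \<phi> v"
      using convex_onD[OF assms(1), of s u v] assms that by simp
    moreover have "(1 - s) *\<^sub>R u + s *\<^sub>R v = u + s *\<^sub>R (v - u)"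
      by (simp add: algebra_simps)
    ultimately have "\<phi> (u + s *\<^sub>R (v - u)) - \<phi> u \<le> (\<phi> v - \<phi> u) * s"
      by (simp add: left_diff_distrib right_diff_distrib mult.commute)
    then show ?thesis
      using that by (simp add: pos_divide_le_eq)
  qed
  then have "eventually (\<lambda>s. (\<phi> (u + s *\<^sub>R (v - u)) - \<phi> u) / s \<le> \<phi> v - \<phi> u) (at_right 0)"
    by (auto simp: eventually_at_right_field intro: exI[of _ 1])
  then have "gradient \<phi> u \<bullet> (v - u) \<le> \<phi> v - \<phi> u"
    by (intro tendsto_upperbound[OF gradient_directional_limit[OF assms(4)]]) auto
  then show ?thesis by simp
qed

locale mirror_geometry =
  fixes D :: "'a::euclidean_space set" and \<phi> :: "'a \<Rightarrow> real"
  assumes open_D: "open D" and convex_D: "convex D" and mirror: "mirror_map D \<phi>"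
begin

lemma differentiable: "u \<in> D \<Longrightarrow> \<phi> differentiable (at u)"
  using mirror by (auto simp: mirror_map_def)

lemma convex_on_D: "convex_on D \<phi>"
proof (rule convex_onI)
  fix s :: real and u v
  assume *: "0 < s" "s < 1" "u \<in> D" "v \<in> D"
  then show "\<phi> ((1 - s) *\<^sub>R u + s *\<^sub>R v) \<le> (1 - s) * \<phi> u + s * \<phi> v"
    using mirror by (cases "u = v")
      (auto simp: mirror_map_def strictly_convex_on_def algebra_simps less_imp_le)
qed (rule convex_D)

text \<open>An open convex set is the interior of its closure, so the divergence that
  \<open>mirror_map\<close> states at \<open>frontier (closure D)\<close> covers exactly the points
  of \<open>closure D\<close> outside \<open>D\<close>.\<close>

lemma frontier_closure_D: "frontier (closure D) = closure D - D"
  using convex_interior_closure[OF convex_D] open_D by (simp add: frontier_def interior_open)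

lemma segment_in_D:
  assumes "z \<in> D" "u \<in> closure D" "0 < s" "s \<le> 1"
  shows "u + s *\<^sub>R (z - u) \<in> D"
  using mem_interior_closure_convex_shrink[OF convex_D, of z u s] assms open_D
  by (simp add: interior_open algebra_simps)

text \<open>The affine left side is continuous, so the gradient inequality on \<open>D\<close>
  survives the lower limit that defines the extension. A single affine minorant keeps the extension
  off \<open>-\<infinity>\<close> on all of \<open>closure D\<close>.\<close>

lemma tangent_le_lsc_extension:
  assumes "u \<in> D" "v \<in> closure D"
  shows "ereal (\<phi> u + gradient \<phi> u \<bullet> (v - u)) \<le> lsc_extension D \<phi> v"
proof (cases "v \<in> D")
  case True
  then show ?thesis
    using gradient_inequality[OF convex_on_D assms(1) True differentiable[OF assms(1)]]
    by (simp add: lsc_extension_def)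
next
  case False
  let ?F = "at v within D"
  have nt: "?F \<noteq> bot"
    using assms False by (metis closure_def UnE mem_Collect_eq trivial_limit_within)
  have "((\<lambda>w. \<phi> u + gradient \<phi> u \<bullet> (w - u)) \<longlongrightarrow> \<phi> u + gradient \<phi> u \<bullet> (v - u)) ?F"
    by (intro tendsto_intros)
  then have "Liminf ?F (\<lambda>w. ereal (\<phi> u + gradient \<phi> u \<bullet> (w - u))) = ereal (\<phi> u + gradient \<phi> u \<bullet> (v - u))"
    by (intro lim_imp_Liminf nt) auto
  moreover have "Liminf ?F (\<lambda>w. ereal (\<phi> u + gradient \<phi> u \<bullet> (w - u))) \<le> Liminf ?F (\<lambda>w. ereal (\<phi> w))"
    using gradient_inequality[OF convex_on_D assms(1) _ differentiable[OF assms(1)]]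
    by (intro Liminf_mono) (auto simp: eventually_at_filter)
  ultimately show ?thesis
    using False by (simp add: lsc_extension_def)
qed

text \<open>A lower bound on the slope along the segment would, tested at the points of a ball around
  \<open>z\<close>, bound the whole gradient, contradicting its divergence at the frontier.\<close>

lemma slope_unbounded_at_frontier:
  assumes y: "y \<in> closure D" "y \<notin> D" and z: "z \<in> D"
  shows "\<exists>s. 0 < s \<and> s < 1 \<and> gradient \<phi> (y + s *\<^sub>R (z - y)) \<bullet> (z - y) < - K"
proof (rule ccontr)
  assume neg: "\<not> ?thesis"
  define u where "u s = y + s *\<^sub>R (z - y)" for s
  have uD: "u s \<in> D" if "0 < s" "s < 1" for s
    using segment_in_D[OF z y(1), of s] that by (simp add: u_def)
  have slope: "- K \<le> gradient \<phi> (u s) \<bullet> (z - y)" if "0 < s" "s < 1" for s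
    using neg that by (force simp: u_def)
  obtain r where r: "0 < r" "cball z r \<subseteq> D"
    using open_D z open_contains_cball by blast
  have "continuous_on (cball z r) \<phi>"
    using r differentiable
    by (meson continuous_at_imp_continuous_on differentiable_imp_continuous_within subset_iff)
  then have "bdd_above (\<phi> ` cball z r)"
    by (intro bounded_imp_bdd_above compact_imp_bounded compact_continuous_image compact_cball)
  then obtain C where C: "\<And>v. v \<in> cball z r \<Longrightarrow> \<phi> v \<le> C"
    unfolding bdd_above_def by blast
  define B where "B = (C + \<bar>K\<bar> - \<phi> z + norm (gradient \<phi> z) * norm (y - z)) / r"
  have bound: "norm (gradient \<phi> (u s)) \<le> B" if s: "0 < s" "s < 1" for s
  proof -
    let ?g = "gradient \<phi> (u s)"
    \<comment> \<open>A step of length \<open>r\<close> along the gradient turns the inner product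
      into \<open>r * norm ?g\<close>; a zero gradient gets the zero step.\<close>
    define e where "e = (if ?g = 0 then 0 else (r / norm ?g) *\<^sub>R ?g)"
    have e: "?g \<bullet> e = r * norm ?g" "norm e \<le> r"
      using r by (auto simp: e_def power2_norm_eq_inner[symmetric] power2_eq_square)
    have ze: "z + e \<in> cball z r"
      using e by (simp add: dist_norm)
    have zus: "z - u s = (1 - s) *\<^sub>R (z - y)"
      by (simp add: u_def algebra_simps)
    have "\<phi> (u s) + ?g \<bullet> (z + e - u s) \<le> \<phi> (z + e)"
      using ze r gradient_inequality[OF convex_on_D uD _ differentiable[OF uD]] s by blast
    moreover have "?g \<bullet> (z + e - u s) = (1 - s) * (?g \<bullet> (z - y)) + r * norm ?g"
    proof -
      have "?g \<bullet> (z + e - u s) = ?g \<bullet> (z - u s) + ?g \<bullet> e"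
        by (simp add: inner_diff_right inner_add_right)
      then show ?thesis by (simp add: zus e)
    qed
    \<comment> \<open>For negative \<open>K\<close> the factor \<open>1 - s\<close> would spoil the
      bound by \<open>- K\<close>, hence the absolute value.\<close>
    moreover have "(1 - s) * (?g \<bullet> (z - y)) \<ge> - \<bar>K\<bar>"
    proof -
      have "(1 - s) * (- \<bar>K\<bar>) \<le> (1 - s) * (?g \<bullet> (z - y))"
        using slope[OF s] s by (intro mult_left_mono) auto
      moreover have "- \<bar>K\<bar> \<le> (1 - s) * (- \<bar>K\<bar>)"
        using s by (simp add: algebra_simps)
      ultimately show ?thesis by linarith
    qed
    moreover have "\<phi> (u s) \<ge> \<phi> z - norm (gradient \<phi> z) * norm (y - z)"
    proof -
      have "\<phi> z + gradient \<phi> z \<bullet> (u s - z) \<le> \<phi> (u s)"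
        using gradient_inequality[OF convex_on_D z uD differentiable[OF z]] s by blast
      moreover have "\<bar>gradient \<phi> z \<bullet> (u s - z)\<bar> \<le> norm (gradient \<phi> z) * norm (u s - z)"
        by (rule Cauchy_Schwarz_ineq2)
      moreover have "norm (u s - z) \<le> norm (y - z)"
      proof -
        have "norm (u s - z) = (1 - s) * norm (y - z)"
          using s by (simp add: norm_minus_commute[of "u s"] zus norm_minus_commute[of y])
        then show ?thesis
          using s by (simp add: mult_left_le_one_le)
      qed
      then have "norm (gradient \<phi> z) * norm (u s - z) \<le> norm (gradient \<phi> z) * norm (y - z)"
        by (simp add: mult_left_mono)
      ultimately show ?thesis by linarith
    qed
    moreover have "\<phi> (z + e) \<le> C"
      using C ze by blast
    ultimately have "r * norm ?g \<le> C + \<bar>K\<bar> - \<phi> z + norm (gradient \<phi> z) * norm (y - z)"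
      by linarith
    then show ?thesis
      using r by (simp add: B_def pos_le_divide_eq mult.commute)
  qed
  have "filterlim (\<lambda>u. norm (gradient \<phi> u)) at_top (at y within D)"
    using mirror y frontier_closure_D by (auto simp: mirror_map_def)
  then have "eventually (\<lambda>u. B < norm (gradient \<phi> u)) (at y within D)"
    by (simp add: filterlim_at_top_dense)
  then obtain d where d: "0 < d" "\<And>v. v \<in> D \<Longrightarrow> v \<noteq> y \<Longrightarrow> dist v y < d \<Longrightarrow> B < norm (gradient \<phi> v)"
    by (auto simp: eventually_at)
  have nz: "norm (z - y) > 0"
    using y z by auto
  \<comment> \<open>Half of the distance bound keeps \<open>u s\<close> within \<open>d\<close> of
    \<open>y\<close>; the cap keeps \<open>s\<close> below 1.\<close>
  define s where "s = min (1/2) (d / (2 * norm (z - y)))"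
  have s: "0 < s" "s < 1" "s * norm (z - y) < d"
  proof -
    show "0 < s" "s < 1" using d nz by (auto simp: s_def)
    have "s * norm (z - y) \<le> d / (2 * norm (z - y)) * norm (z - y)"
      using nz by (intro mult_right_mono) (auto simp: s_def)
    then show "s * norm (z - y) < d" using nz d by simp
  qed
  have "B < norm (gradient \<phi> (u s))"
    using uD[of s] s y by (intro d) (auto simp: u_def dist_norm)
  with bound[of s] s show False by simp
qed

text \<open>From a frontier point, some move towards \<open>z\<close> lowers \<open>\<phi>\<close>
  faster than any prescribed slope, while \<open>g\<close> rises at most linearly by convexity; so a
  minimizer lies in \<open>D\<close>. There \<open>\<phi>\<close> has a gradient, and comparing with
  points of the segment to \<open>u\<close>, dividing by \<open>s\<close> and letting
  \<open>s\<close> tend to 0 yields the variational inequality without any subgradient of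
  \<open>g\<close>. Convexity is asked at finite values only, which keeps \<open>b - a\<close>
  meaningful.\<close>

lemma composite_minimizer:
  fixes g :: "'a \<Rightarrow> ereal"
  assumes X: "convex X" "X \<subseteq> closure D" and \<rho>: "0 < \<rho>"
    and g_fin: "\<And>u. u \<in> X \<Longrightarrow> g u \<noteq> -\<infinity>"
    and g_conv: "\<And>u v s a b. u \<in> X \<Longrightarrow> v \<in> X \<Longrightarrow> g u = ereal a \<Longrightarrow> g v = ereal b \<Longrightarrow> 0 < s \<Longrightarrow> s < 1
      \<Longrightarrow> g (u + s *\<^sub>R (v - u)) \<le> ereal (a + s * (b - a))"
    and z: "z \<in> X" "z \<in> D" "g z \<noteq> \<infinity>"
    and min: "is_arg_min (\<lambda>u. g u + ereal \<rho> * lsc_extension D \<phi> u) (\<lambda>u. u \<in> X) y"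
  shows "y \<in> D" "g y \<noteq> \<infinity>"
    and "\<And>u a b. u \<in> X \<Longrightarrow> g y = ereal a \<Longrightarrow> g u = ereal b \<Longrightarrow>
      a - b \<le> \<rho> * (gradient \<phi> y \<bullet> (u - y))"
proof -
  let ?h = "\<lambda>u. g u + ereal \<rho> * lsc_extension D \<phi> u"
  have yX: "y \<in> X" and le: "\<And>u. u \<in> X \<Longrightarrow> ?h y \<le> ?h u"
    using min by (auto simp: is_arg_min_def not_less)
  obtain gz where gz: "g z = ereal gz"
    using z g_fin[of z] by (cases "g z") auto
  have "?h y \<le> ereal (gz + \<rho> * \<phi> z)"
    using le[OF z(1)] z gz by (simp add: lsc_extension_def)
  moreover have ly: "lsc_extension D \<phi> y \<noteq> -\<infinity>"
    using tangent_le_lsc_extension[OF z(2), of y] yX X by auto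
  moreover have "g y \<noteq> -\<infinity>" using g_fin yX by blast
  ultimately obtain gy \<phi>y where gy: "g y = ereal gy" and \<phi>y: "lsc_extension D \<phi> y = ereal \<phi>y"
    using \<rho> by (cases "g y"; cases "lsc_extension D \<phi> y") auto
  show "g y \<noteq> \<infinity>" using gy by simp
  show yD: "y \<in> D"
  proof (rule ccontr)
    assume nD: "y \<notin> D"
    \<comment> \<open>The threshold is the chord slope of \<open>g\<close> divided by
      \<open>\<rho>\<close>, so that the fall of \<open>\<rho> * \<phi>\<close> outweighs the rise
      of \<open>g\<close>.\<close>
    obtain s where s: "0 < s" "s < 1"
      and slope: "gradient \<phi> (y + s *\<^sub>R (z - y)) \<bullet> (z - y) < - ((gz - gy) / \<rho>)"
      using slope_unbounded_at_frontier[OF _ nD z(2)] yX X by blast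
    define u where "u = y + s *\<^sub>R (z - y)"
    have uD: "u \<in> D"
      using segment_in_D[OF z(2), of y s] yX X s by (auto simp: u_def)
    have uX: "u \<in> X"
      using convexD_alt[OF X(1) yX z(1), of s] s by (simp add: u_def algebra_simps)
    have gu: "g u \<le> ereal (gy + s * (gz - gy))"
      using g_conv[OF yX z(1) gy gz s] by (simp add: u_def)
    then obtain gu where gu': "g u = ereal gu" "gu \<le> gy + s * (gz - gy)"
      using g_fin[OF uX] by (cases "g u") auto
    \<comment> \<open>The tangent is taken at \<open>u\<close> and evaluated at \<open>y\<close>,
      where no gradient is available.\<close>
    have "y - u = - (s *\<^sub>R (z - y))" by (simp add: u_def)
    then have "\<phi> u - s * (gradient \<phi> u \<bullet> (z - y)) \<le> \<phi>y"
      using tangent_le_lsc_extension[OF uD, of y] yX X \<phi>y by auto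
    moreover have "s * (gradient \<phi> u \<bullet> (z - y)) < s * (- ((gz - gy) / \<rho>))"
      using slope s unfolding u_def by (intro mult_strict_left_mono) auto
    ultimately have "\<phi> u < \<phi>y - s * ((gz - gy) / \<rho>)" by simp
    then have "\<rho> * \<phi> u < \<rho> * (\<phi>y - s * ((gz - gy) / \<rho>))"
      using \<rho> by simp
    also have "\<dots> = \<rho> * \<phi>y - s * (gz - gy)"
      using \<rho> by (simp add: field_simps)
    finally have "gu + \<rho> * \<phi> u < gy + \<rho> * \<phi>y" using gu' by simp
    moreover have "gy + \<rho> * \<phi>y \<le> gu + \<rho> * \<phi> u"
      using le[OF uX] gy \<phi>y gu' uD by (simp add: lsc_extension_def)
    ultimately show False by simp
  qed
  fix u a b assume u: "u \<in> X" "g y = ereal a" "g u = ereal b"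
  obtain e where e: "0 < e" "ball y e \<subseteq> D"
    using open_D yD open_contains_ball by blast
  \<comment> \<open>Below \<open>d\<close> the segment stays in the ball around \<open>y\<close>;
    the added 1 covers \<open>u = y\<close>.\<close>
  define d where "d = min 1 (e / (norm (u - y) + 1))"
  have d: "0 < d" using e by (simp add: d_def add_nonneg_pos)
  have "(a - b) / \<rho> \<le> (\<phi> (y + s *\<^sub>R (u - y)) - \<phi> y) / s" if s: "0 < s" "s < d" for s
  proof -
    have s1: "s < 1" using s by (simp add: d_def)
    let ?u = "y + s *\<^sub>R (u - y)"
    have "s * norm (u - y) \<le> s * (norm (u - y) + 1)" using s by simp
    also have "\<dots> < e"
      using s by (simp add: d_def pos_less_divide_eq add_nonneg_pos)
    finally have uD: "?u \<in> D"
      using e s by (intro subsetD[OF e(2)]) (simp add: dist_norm)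
    have uX: "?u \<in> X"
      using convexD_alt[OF X(1) yX u(1), of s] s s1 by (simp add: algebra_simps)
    have "g ?u \<le> ereal (a + s * (b - a))"
      using g_conv[OF yX u(1) u(2,3)] s s1 by simp
    then obtain c where c: "g ?u = ereal c" "c \<le> a + s * (b - a)"
      using g_fin[OF uX] by (cases "g ?u") auto
    have "a + \<rho> * \<phi> y \<le> c + \<rho> * \<phi> ?u"
      using le[OF uX] u c uD yD by (simp add: lsc_extension_def)
    then have "s * (a - b) \<le> \<rho> * (\<phi> ?u - \<phi> y)"
      using c by (simp add: algebra_simps)
    then show ?thesis
      using s \<rho> by (simp add: field_simps)
  qed
  then have "eventually (\<lambda>s. (a - b) / \<rho> \<le> (\<phi> (y + s *\<^sub>R (u - y)) - \<phi> y) / s) (at_right 0)"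
    using d by (auto simp: eventually_at_right_field)
  then have "(a - b) / \<rho> \<le> gradient \<phi> y \<bullet> (u - y)"
    by (intro tendsto_lowerbound[OF gradient_directional_limit[OF differentiable[OF yD]]]) auto
  then show "a - b \<le> \<rho> * (gradient \<phi> y \<bullet> (u - y))"
    using \<rho> by (simp add: pos_divide_le_eq mult.commute)
qed

end

section \<open>Comparison of norms\<close>

text \<open>Divided by the norm \<open>N\<close>, the absolute coordinates lie between 0 and 1,
  where squares are at most \<open>r\<close>-th powers because \<open>r \<le> 2\<close>, and the
  normalized \<open>r\<close>-th powers sum to 1.\<close>

lemma lp_norm_ge_norm:
  fixes v :: "real ^ 'n"
  assumes r: "1 \<le> r" "r \<le> 2"
  shows "norm v \<le> lp_norm (ereal r) v"
proof (cases "v = 0")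
  case False
  define N where "N = lp_norm (ereal r) v"
  have N: "N = (\<Sum>k\<in>UNIV. \<bar>v $ k\<bar> powr r) powr (1 / r)"
    by (simp add: N_def lp_norm_def)
  have pos: "0 < (\<Sum>k\<in>UNIV. \<bar>v $ k\<bar> powr r)"
  proof -
    obtain k where "v $ k \<noteq> 0" using False by (auto simp: vec_eq_iff)
    then show ?thesis by (intro sum_pos2[of _ k]) auto
  qed
  then have N0: "0 < N" by (simp add: N)
  have Nr: "N powr r = (\<Sum>k\<in>UNIV. \<bar>v $ k\<bar> powr r)"
    using r pos by (simp add: N powr_powr)
  have le: "\<bar>v $ k\<bar> \<le> N" for k
  proof -
    have "\<bar>v $ k\<bar> powr r \<le> N powr r"
      unfolding Nr by (rule member_le_sum) auto
    then show ?thesis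
      using powr_less_mono2[of r N "\<bar>v $ k\<bar>"] r N0 by linarith
  qed
  have "(\<bar>v $ k\<bar> / N)\<^sup>2 \<le> (\<bar>v $ k\<bar> / N) powr r" for k
  proof (cases "v $ k = 0")
    case nz: False
    have "(\<bar>v $ k\<bar> / N) powr 2 \<le> (\<bar>v $ k\<bar> / N) powr r"
      using le[of k] N0 nz r by (intro powr_mono') auto
    then show ?thesis using N0 nz by (simp flip: powr_numeral)
  qed simp
  then have "(\<Sum>k\<in>UNIV. (\<bar>v $ k\<bar> / N)\<^sup>2) \<le> (\<Sum>k\<in>UNIV. (\<bar>v $ k\<bar> / N) powr r)"
    by (rule sum_mono)
  also have "\<dots> = (\<Sum>k\<in>UNIV. \<bar>v $ k\<bar> powr r) / N powr r"
    using N0 by (simp add: powr_divide sum_divide_distrib)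
  also have "\<dots> = 1" using Nr pos by simp
  finally have "(\<Sum>k\<in>UNIV. (v $ k)\<^sup>2) / N\<^sup>2 \<le> 1"
    by (simp add: power_divide sum_divide_distrib)
  then have "(norm v)\<^sup>2 \<le> N\<^sup>2"
    using N0 by (simp add: norm_vec_def L2_set_def sum_nonneg)
  then show ?thesis
    using power2_le_imp_le N0 unfolding N_def by fastforce
qed (simp add: lp_norm_def)

text \<open>Jensen is applied below to squared coordinates, which may vanish, so the domain must
  contain 0. If an endpoint is 0, the claim reduces to \<open>c powr q \<le> c\<close> for
  \<open>c\<close> between 0 and 1.\<close>

lemma convex_on_powr_nonneg:
  assumes q: "1 \<le> q"
  shows "convex_on {0..} (\<lambda>x::real. x powr q)"
proof (rule convex_onI)
  fix s x y :: real
  assume s: "0 < s" "s < 1" and xy: "x \<in> {0..}" "y \<in> {0..}"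
  have scale: "(c * z) powr q \<le> c * z powr q" if "0 < c" "c < 1" "0 \<le> z" for c z :: real
  proof -
    have "c powr q \<le> c powr 1" using that q by (intro powr_mono') auto
    then have "c powr q * z powr q \<le> c * z powr q" using that by (intro mult_right_mono) auto
    then show ?thesis using that by (simp add: powr_mult)
  qed
  show "((1 - s) *\<^sub>R x + s *\<^sub>R y) powr q \<le> (1 - s) * x powr q + s * y powr q"
  proof (cases "x = 0 \<or> y = 0")
    case True
    then show ?thesis
      using scale[of s y] scale[of "1 - s" x] s xy q by auto
  next
    case False
    then show ?thesis
      using convex_onD[OF powr_convex[OF q], of s x y] s xy by auto
  qed
qed simp

text \<open>Jensen for the power \<open>r / 2\<close>, applied to the mean of the squared
  coordinates. The factor in front collects the two normalizations by the dimension.\<close>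

lemma lp_norm_power_mean:
  fixes v :: "real ^ 'n"
  assumes r: "2 \<le> r"
  shows "real CARD('n) powr (2 / r - 1) * (norm v)\<^sup>2 \<le> (lp_norm (ereal r) v)\<^sup>2"
proof -
  let ?n = "real CARD('n)"
  have n: "0 < ?n" by simp
  define a where "a = (norm v)\<^sup>2 / ?n"
  have a: "a = (\<Sum>k\<in>UNIV. (1 / ?n) *\<^sub>R (v $ k)\<^sup>2)"
    by (simp add: a_def norm_vec_def L2_set_def sum_nonneg sum_divide_distrib)
  have "convex_on {0..} (\<lambda>x::real. x powr (r / 2))"
    using r by (intro convex_on_powr_nonneg) auto
  then have "a powr (r / 2) \<le> (\<Sum>k\<in>UNIV. 1 / ?n * (v $ k)\<^sup>2 powr (r / 2))"
    unfolding a using n by (intro convex_on_sum) auto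
  also have "\<dots> = (\<Sum>k\<in>UNIV. \<bar>v $ k\<bar> powr r) / ?n"
  proof -
    have "(v $ k)\<^sup>2 powr (r / 2) = \<bar>v $ k\<bar> powr r" for k
      using powr_powr[of "\<bar>v $ k\<bar>" 2 "r / 2"] by (cases "v $ k = 0") (auto simp: powr_numeral)
    then show ?thesis by (simp add: sum_divide_distrib)
  qed
  finally have "(a powr (r / 2)) powr (2 / r) \<le> ((\<Sum>k\<in>UNIV. \<bar>v $ k\<bar> powr r) / ?n) powr (2 / r)"
    using r by (intro powr_mono2) auto
  moreover have "(a powr (r / 2)) powr (2 / r) = a"
    using r by (simp add: powr_powr a_def)
  ultimately have "a \<le> (\<Sum>k\<in>UNIV. \<bar>v $ k\<bar> powr r) powr (2 / r) / ?n powr (2 / r)"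
    by (simp add: powr_divide sum_nonneg)
  moreover have "(\<Sum>k\<in>UNIV. \<bar>v $ k\<bar> powr r) powr (2 / r) = (lp_norm (ereal r) v)\<^sup>2"
  proof -
    let ?s = "\<Sum>k\<in>UNIV. \<bar>v $ k\<bar> powr r"
    have "2 / r = 1 / r + 1 / r" by simp
    then have "?s powr (2 / r) = (?s powr (1 / r))\<^sup>2"
      by (simp only: powr_add power2_eq_square)
    then show ?thesis by (simp add: lp_norm_def)
  qed
  ultimately have "?n powr (2 / r) * ((norm v)\<^sup>2 / ?n) \<le> (lp_norm (ereal r) v)\<^sup>2"
    by (simp add: a_def pos_le_divide_eq mult.commute)
  then show ?thesis
    by (simp add: powr_diff)
qed

text \<open>The two arguments of the minimum serve different ranges: 1 for \<open>p \<le> 2\<close>,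
  the power mean factor beyond it. At \<open>p = \<infinity>\<close> the quotient
  \<open>2 / p\<close> is 0 and that factor becomes 1 over the dimension.\<close>

lemma lp_norm_comparison:
  fixes v :: "real ^ 'n"
  assumes p: "1 \<le> p"
    and \<sigma>: "\<sigma> = min 1 (real CARD('n) powr (real_of_ereal (2 / p) - 1))"
  shows "\<sigma> * (norm v)\<^sup>2 \<le> (lp_norm p v)\<^sup>2"
proof (cases p)
  case PInf
  have "norm v \<le> sqrt (real CARD('n)) * lp_norm p v"
    using norm_le_infnorm[of v] PInf by (simp add: lp_norm_def)
  then have "(norm v)\<^sup>2 \<le> (sqrt (real CARD('n)) * lp_norm p v)\<^sup>2"
    by (intro power_mono) auto
  then have "(norm v)\<^sup>2 \<le> real CARD('n) * (lp_norm p v)\<^sup>2"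
    by (simp add: power_mult_distrib)
  moreover have "\<sigma> \<le> 1 / real CARD('n)"
    by (simp add: \<sigma> PInf powr_minus_divide)
  then have "\<sigma> * (norm v)\<^sup>2 \<le> 1 / real CARD('n) * (norm v)\<^sup>2"
    by (rule mult_right_mono) simp
  moreover have "1 / real CARD('n) * (norm v)\<^sup>2 \<le> (lp_norm p v)\<^sup>2"
    using calculation(1) by (simp add: pos_divide_le_eq mult.commute)
  ultimately show ?thesis by linarith
next
  case (real r)
  then have r: "1 \<le> r" and \<sigma>': "\<sigma> = min 1 (real CARD('n) powr (2 / r - 1))"
    using p \<sigma> by (auto simp: one_ereal_def)
  show ?thesis
  proof (cases "r \<le> 2")
    case True
    have "\<sigma> * (norm v)\<^sup>2 \<le> 1 * (norm v)\<^sup>2"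
      by (rule mult_right_mono) (simp_all add: \<sigma>')
    also have "\<dots> \<le> (lp_norm p v)\<^sup>2"
      using lp_norm_ge_norm[OF r True, of v] real by (simp add: power_mono)
    finally show ?thesis .
  next
    case False
    have "\<sigma> * (norm v)\<^sup>2 \<le> real CARD('n) powr (2 / r - 1) * (norm v)\<^sup>2"
      by (rule mult_right_mono) (simp_all add: \<sigma>')
    also have "\<dots> \<le> (lp_norm p v)\<^sup>2"
      using lp_norm_power_mean[of r v] False real by simp
    finally show ?thesis .
  qed
qed (use p in auto)

section \<open>The graph Laplacian of a symmetric stochastic matrix\<close>

text \<open>The blocks of \<open>(Q \<otimes> I) x\<close>, so that the Kronecker product disappears
  after \<open>QI_stack\<close>. The general codomain allows the same operator on scalar
  coordinates.\<close>

definition laplacian :: "real ^ 'v ^ 'v \<Rightarrow> ('v::finite \<Rightarrow> 'a::real_vector) \<Rightarrow> 'v \<Rightarrow> 'a" where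
  "laplacian P x i = x i - (\<Sum>j\<in>UNIV. P $ i $ j *\<^sub>R x j)"

lemma QI_stack: "QI P *v stack x = stack (laplacian P x)"
proof -
  have "(QI P *v stack x) $ (i, k) = stack (laplacian P x) $ (i, k)" for i k
  proof -
    have "(QI P *v stack x) $ (i, k) =
        (\<Sum>q\<in>UNIV. ((mat 1 $ i $ fst q - P $ i $ fst q) * mat 1 $ k $ snd q) * x (fst q) $ snd q)"
      by (simp add: matrix_vector_mult_def QI_def kronecker_def stack_def)
    also have "\<dots> = (\<Sum>j\<in>UNIV. \<Sum>l\<in>UNIV. ((mat 1 $ i $ j - P $ i $ j) * mat 1 $ k $ l) * x j $ l)"
      by (simp add: sum.cartesian_product case_prod_beta flip: UNIV_Times_UNIV)
    also have "\<dots> = (\<Sum>j\<in>UNIV. (mat 1 $ i $ j - P $ i $ j) * x j $ k)"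
      by (simp add: mat_def if_distrib[of "\<lambda>c. _ * c * _"] mult.assoc sum.delta
          if_distrib[of "\<lambda>c. c * _"] if_distrib[of "\<lambda>c. _ * c"] cong: if_cong)
    also have "\<dots> = (\<Sum>j\<in>UNIV. mat 1 $ i $ j * x j $ k) - (\<Sum>j\<in>UNIV. P $ i $ j * x j $ k)"
      by (simp add: left_diff_distrib sum_subtractf)
    also have "(\<Sum>j\<in>UNIV. mat 1 $ i $ j * x j $ k) = x i $ k"
      by (simp add: mat_def if_distrib[of "\<lambda>c. c * _"] cong: if_cong)
    finally show ?thesis
      by (simp add: stack_def laplacian_def)
  qed
  then show ?thesis by (simp add: vec_eq_iff)
qed

lemma inner_stack: "stack x \<bullet> stack y = (\<Sum>i\<in>UNIV. x i \<bullet> y i)"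
  by (simp add: inner_vec_def stack_def sum.cartesian_product case_prod_beta flip: UNIV_Times_UNIV)

lemma norm_stack: "(norm (stack x))\<^sup>2 = (\<Sum>i\<in>UNIV. (norm (x i))\<^sup>2)"
  by (simp add: power2_norm_eq_inner inner_stack)

lemma stack_diff: "stack x - stack y = stack (\<lambda>i. x i - y i)"
  and stack_scaleR: "c *\<^sub>R stack x = stack (\<lambda>i. c *\<^sub>R x i)"
  by (simp_all add: vec_eq_iff stack_def)

locale symmetric_stochastic =
  fixes P :: "real ^ 'v::finite ^ 'v"
  assumes symmetric: "transpose P = P" and stochastic: "stochastic_matrix P"
begin

lemma sym_entry: "P $ i $ j = P $ j $ i"
  using arg_cong[OF symmetric, of "\<lambda>A. A $ j $ i"] by (simp add: transpose_def)

lemma nonneg: "0 \<le> P $ i $ j"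
  using stochastic by (simp add: stochastic_matrix_def)

lemma row_sum: "(\<Sum>j\<in>UNIV. P $ i $ j) = 1"
  using stochastic by (simp add: stochastic_matrix_def)

lemma col_sum: "(\<Sum>i\<in>UNIV. P $ i $ j) = 1"
  using row_sum[of j] by (subst sym_entry)

text \<open>Symmetry makes the column sums 1 as well, so each \<open>c j\<close> is counted with
  total weight 1.\<close>

lemma row_average: "(\<Sum>i\<in>UNIV. \<Sum>j\<in>UNIV. P $ i $ j * c j) = (\<Sum>j\<in>UNIV. c j)"
proof -
  have "(\<Sum>i\<in>UNIV. \<Sum>j\<in>UNIV. P $ i $ j * c j) = (\<Sum>j\<in>UNIV. (\<Sum>i\<in>UNIV. P $ i $ j) * c j)"
    by (subst sum.swap) (simp add: sum_distrib_right)
  then show ?thesis by (simp add: col_sum)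
qed

lemma laplacian_self_adjoint:
  fixes x y :: "'v \<Rightarrow> 'a::real_inner"
  shows "(\<Sum>i\<in>UNIV. laplacian P x i \<bullet> y i) = (\<Sum>i\<in>UNIV. x i \<bullet> laplacian P y i)"
proof -
  have "(\<Sum>i\<in>UNIV. (\<Sum>j\<in>UNIV. P $ i $ j *\<^sub>R x j) \<bullet> y i) = (\<Sum>i\<in>UNIV. \<Sum>j\<in>UNIV. P $ i $ j * (x j \<bullet> y i))"
    by (simp add: inner_sum_left)
  also have "\<dots> = (\<Sum>i\<in>UNIV. \<Sum>j\<in>UNIV. P $ i $ j * (x i \<bullet> y j))"
    by (subst sum.swap) (simp add: sym_entry)
  also have "\<dots> = (\<Sum>i\<in>UNIV. x i \<bullet> (\<Sum>j\<in>UNIV. P $ i $ j *\<^sub>R y j))"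
    by (simp add: inner_sum_right)
  finally show ?thesis
    by (simp add: laplacian_def inner_diff_left inner_diff_right sum_subtractf)
qed

lemma dirichlet_form:
  fixes x :: "'v \<Rightarrow> 'a::real_inner"
  shows "2 * (\<Sum>i\<in>UNIV. x i \<bullet> laplacian P x i) = (\<Sum>i\<in>UNIV. \<Sum>j\<in>UNIV. P $ i $ j * (norm (x i - x j))\<^sup>2)"
proof -
  have "(\<Sum>i\<in>UNIV. \<Sum>j\<in>UNIV. P $ i $ j * (norm (x i - x j))\<^sup>2) =
      (\<Sum>i\<in>UNIV. \<Sum>j\<in>UNIV. P $ i $ j * (x i \<bullet> x i)) + (\<Sum>i\<in>UNIV. \<Sum>j\<in>UNIV. P $ i $ j * (x j \<bullet> x j))
       - 2 * (\<Sum>i\<in>UNIV. \<Sum>j\<in>UNIV. P $ i $ j * (x i \<bullet> x j))"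
    by (simp add: power2_norm_eq_inner inner_diff_left inner_diff_right inner_commute algebra_simps
        sum.distrib sum_subtractf sum_distrib_left)
  also have "(\<Sum>i\<in>UNIV. \<Sum>j\<in>UNIV. P $ i $ j * (x i \<bullet> x i)) = (\<Sum>i\<in>UNIV. x i \<bullet> x i)"
    by (simp add: row_sum flip: sum_distrib_right)
  also have "(\<Sum>i\<in>UNIV. \<Sum>j\<in>UNIV. P $ i $ j * (x j \<bullet> x j)) = (\<Sum>i\<in>UNIV. x i \<bullet> x i)"
    by (rule row_average)
  finally show ?thesis
    by (simp add: laplacian_def inner_diff_right inner_sum_right sum_subtractf)
qed

text \<open>A vanishing Dirichlet form forces equality across every nonzero entry of
  \<open>P\<close>. A nonzero entry of a power of \<open>P\<close> comes from a walk along such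
  entries, and irreducibility joins any two nodes by one.\<close>

lemma harmonic_constant:
  fixes x :: "'v \<Rightarrow> 'a::real_inner"
  assumes irr: "irreducible_matrix P" and harm: "\<And>i. laplacian P x i = 0"
  shows "x i = x j"
proof -
  have "(\<Sum>i\<in>UNIV. \<Sum>j\<in>UNIV. P $ i $ j * (norm (x i - x j))\<^sup>2) = 0"
    using dirichlet_form[of x] harm by simp
  then have "P $ i $ j * (norm (x i - x j))\<^sup>2 = 0" for i j
    by (simp add: sum_nonneg_eq_0_iff sum_nonneg nonneg)
  then have edge: "P $ i $ j \<noteq> 0 \<Longrightarrow> x i = x j" for i j
    by fastforce
  have "matrix_power P k $ i $ j \<noteq> 0 \<Longrightarrow> x i = x j" for k i j
  proof (induction k arbitrary: i)
    case 0
    then show ?case by (auto simp: matrix_power_def mat_def split: if_splits)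
  next
    case (Suc k)
    then have "(\<Sum>l\<in>UNIV. P $ i $ l * matrix_power P k $ l $ j) \<noteq> 0"
      by (simp add: matrix_power_def matrix_matrix_mult_def)
    then obtain l where "P $ i $ l * matrix_power P k $ l $ j \<noteq> 0"
      by (meson sum.neutral)
    then show ?case using edge Suc.IH by (metis mult_eq_0_iff)
  qed
  then show ?thesis
    using irr by (metis irreducible_matrix_def less_irrefl)
qed

text \<open>\<open>P - P\<^sup>2 = P (I - P) P + (I - P) P (I - P)\<close> is positive semidefinite.\<close>

lemma norm_mult_le_quadratic_form:
  assumes "positive_semidefinite P"
  shows "(norm (P *v v))\<^sup>2 \<le> v \<bullet> (P *v v)"
proof -
  have adj: "a \<bullet> (P *v b) = (P *v a) \<bullet> b" for a b
    using dot_lmul_matrix[of a P b] transpose_matrix_vector[of P a] symmetric by simp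
  \<comment> \<open>\<open>I - P\<close> is positive semidefinite, being half a Dirichlet form with
    nonnegative weights.\<close>
  have contr: "0 \<le> u \<bullet> (u - P *v u)" for u :: "real ^ 'v"
  proof -
    have "2 * (\<Sum>i\<in>UNIV. u $ i \<bullet> laplacian P (($) u) i) \<ge> 0"
      unfolding dirichlet_form by (intro sum_nonneg mult_nonneg_nonneg nonneg) auto
    then show ?thesis
      by (simp add: inner_vec_def laplacian_def matrix_vector_mult_def)
  qed
  let ?w = "v - P *v v"
  have "0 \<le> ?w \<bullet> (P *v ?w) + (P *v v) \<bullet> (P *v v - P *v (P *v v))"
    using assms contr by (simp add: positive_semidefinite_def)
  also have "\<dots> = v \<bullet> (P *v v) - (P *v v) \<bullet> (P *v v)"
  proof -
    have "?w \<bullet> (P *v ?w) = v \<bullet> (P *v v) - v \<bullet> (P *v (P *v v)) - (P *v v) \<bullet> (P *v v)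
        + (P *v v) \<bullet> (P *v (P *v v))"
      by (simp add: matrix_vector_mult_diff_distrib inner_diff_left inner_diff_right)
    then show ?thesis
      using adj[of v "P *v v"] by (simp add: inner_diff_right)
  qed
  finally show ?thesis
    by (simp add: power2_norm_eq_inner)
qed

text \<open>Replacing each \<open>y i\<close> by the weighted mean \<open>a i\<close> can only
  shrink the right side and leaves |x|^2 - |P x|^2. So the claim amounts to (I - P)^2 \<le> I - P^2,
  that is P^2 \<le> P, which fails as soon as \<open>P\<close> has a negative eigenvalue.\<close>

lemma laplacian_le_spread:
  fixes x y :: "'v \<Rightarrow> real ^ 'n"
  assumes psd: "positive_semidefinite P"
  shows "(\<Sum>i\<in>UNIV. (norm (laplacian P x i))\<^sup>2)
    \<le> (\<Sum>i\<in>UNIV. \<Sum>j\<in>UNIV. P $ i $ j * (norm (y i - x j))\<^sup>2)"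
proof -
  define a where "a i = (\<Sum>j\<in>UNIV. P $ i $ j *\<^sub>R x j)" for i
  have "(\<Sum>i\<in>UNIV. (norm (a i))\<^sup>2) \<le> (\<Sum>i\<in>UNIV. x i \<bullet> a i)"
  proof -
    \<comment> \<open>\<open>P\<close> acts on scalars, so its inequality is applied to each
      coordinate \<open>k\<close> of the blocks separately.\<close>
    let ?v = "\<lambda>k. \<chi> i. x i $ k"
    have comp: "(P *v ?v k) $ i = a i $ k" for i k
      by (simp add: a_def matrix_vector_mult_def)
    have "(\<Sum>i\<in>UNIV. (norm (a i))\<^sup>2) = (\<Sum>i\<in>UNIV. \<Sum>k\<in>UNIV. a i $ k * a i $ k)"
      by (simp add: power2_norm_eq_inner inner_vec_def)
    also have "\<dots> = (\<Sum>k\<in>UNIV. (norm (P *v ?v k))\<^sup>2)"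
      by (subst sum.swap) (simp add: power2_norm_eq_inner inner_vec_def comp)
    also have "\<dots> \<le> (\<Sum>k\<in>UNIV. ?v k \<bullet> (P *v ?v k))"
      by (intro sum_mono norm_mult_le_quadratic_form psd)
    also have "\<dots> = (\<Sum>i\<in>UNIV. \<Sum>k\<in>UNIV. x i $ k * a i $ k)"
      by (subst sum.swap) (simp add: inner_vec_def comp)
    also have "\<dots> = (\<Sum>i\<in>UNIV. x i \<bullet> a i)"
      by (simp add: inner_vec_def)
    finally show ?thesis .
  qed
  then have "(\<Sum>i\<in>UNIV. (norm (laplacian P x i))\<^sup>2) \<le> (\<Sum>i\<in>UNIV. x i \<bullet> x i - a i \<bullet> a i)"
    by (simp add: laplacian_def power2_norm_eq_inner inner_diff_left inner_diff_right inner_commute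
        sum.distrib sum_subtractf flip: a_def sum_distrib_left)
  also have "\<dots> = (\<Sum>i\<in>UNIV. (\<Sum>j\<in>UNIV. P $ i $ j * (x j \<bullet> x j)) - a i \<bullet> a i)"
    by (simp add: sum_subtractf row_average)
  also have "\<dots> \<le> (\<Sum>i\<in>UNIV. \<Sum>j\<in>UNIV. P $ i $ j * (norm (y i - x j))\<^sup>2)"
  proof (intro sum_mono)
    fix i
    have "(\<Sum>j\<in>UNIV. P $ i $ j * (norm (y i - x j))\<^sup>2) =
        (\<Sum>j\<in>UNIV. P $ i $ j * (y i \<bullet> y i)) + (\<Sum>j\<in>UNIV. P $ i $ j * (x j \<bullet> x j))
         - 2 * (\<Sum>j\<in>UNIV. P $ i $ j * (y i \<bullet> x j))"
      by (simp add: power2_norm_eq_inner inner_diff_left inner_diff_right inner_commute algebra_simps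
          sum.distrib sum_subtractf sum_distrib_left)
    also have "\<dots> = y i \<bullet> y i + (\<Sum>j\<in>UNIV. P $ i $ j * (x j \<bullet> x j)) - 2 * (y i \<bullet> a i)"
      by (simp add: row_sum a_def inner_sum_right flip: sum_distrib_right)
    finally have "(\<Sum>j\<in>UNIV. P $ i $ j * (norm (y i - x j))\<^sup>2) =
        (\<Sum>j\<in>UNIV. P $ i $ j * (x j \<bullet> x j)) - a i \<bullet> a i + (norm (y i - a i))\<^sup>2"
      by (simp add: power2_norm_eq_inner inner_diff_left inner_diff_right inner_commute)
    then show "(\<Sum>j\<in>UNIV. P $ i $ j * (x j \<bullet> x j)) - a i \<bullet> a i
        \<le> (\<Sum>j\<in>UNIV. P $ i $ j * (norm (y i - x j))\<^sup>2)"
      by simp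
  qed
  finally show ?thesis .
qed

end

section \<open>Random node selection\<close>

definition selections :: "real \<Rightarrow> 'v::finite set set" where
  "selections \<omega> = {A. real (card A) / real CARD('v) = \<omega>}"

definition histories :: "real \<Rightarrow> nat \<Rightarrow> 'v::finite set list set" where
  "histories \<omega> t = {h. length h = t \<and> set h \<subseteq> selections \<omega>}"

text \<open>Entry \<open>s\<close> is \<open>S (Suc s)\<close>, since selections are numbered from
  1; a list of length \<open>t\<close> holds what the iterates at time \<open>t\<close> can depend
  on.\<close>

definition history :: "(nat \<Rightarrow> 'w \<Rightarrow> 'v set) \<Rightarrow> nat \<Rightarrow> 'w \<Rightarrow> 'v set list" where
  "history S t w = map (\<lambda>s. S (Suc s) w) [0..<t]"

lemma history_Suc: "history S (Suc t) w = history S t w @ [S (Suc t) w]"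
  by (simp add: history_def)

lemma length_history [simp]: "length (history S t w) = t"
  by (simp add: history_def)

lemma finite_histories: "finite (histories \<omega> t :: 'v::finite set list set)"
  using finite_lists_length_eq[of "selections \<omega> :: 'v set set" t]
  by (simp add: histories_def conj_commute)

text \<open>Appending the newest set at the end groups the longer histories by their past; the inner
  sum is, up to normalization, the conditional expectation.\<close>

lemma sum_histories_Suc:
  fixes G :: "'v::finite set list \<Rightarrow> 'b::comm_monoid_add"
  shows "(\<Sum>h\<in>histories \<omega> (Suc t). G h) = (\<Sum>h\<in>histories \<omega> t. \<Sum>A\<in>selections \<omega>. G (h @ [A]))"
proof -
  have "histories \<omega> (Suc t) = (\<lambda>p. fst p @ [snd p]) ` (histories \<omega> t \<times> (selections \<omega> :: 'v set set))"
  proof (intro equalityI subsetI)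
    fix h :: "'v set list" assume h: "h \<in> histories \<omega> (Suc t)"
    then obtain h' A where "h = h' @ [A]"
      by (cases h rule: rev_cases) (auto simp: histories_def)
    with h show "h \<in> (\<lambda>p. fst p @ [snd p]) ` (histories \<omega> t \<times> selections \<omega>)"
      by (auto simp: histories_def intro!: image_eqI[of _ _ "(h', A)"])
  qed (auto simp: histories_def)
  moreover have "inj_on (\<lambda>p. fst p @ [snd p]) (histories \<omega> t \<times> (selections \<omega> :: 'v set set))"
    by (auto simp: inj_on_def prod_eq_iff)
  ultimately show ?thesis
    by (simp add: sum.reindex sum.cartesian_product case_prod_beta)
qed

text \<open>Removing \<open>i\<close> identifies these sets with the \<open>(k - 1)\<close>-subsets
  of the other nodes, and absorbing a factor into the binomial coefficient gives the proportion
  \<open>k / m\<close>, which is \<open>\<omega>\<close>. A member of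
  \<open>selections \<omega>\<close> supplies the integer \<open>k\<close>.\<close>

lemma card_selections_containing:
  assumes ne: "selections \<omega> \<noteq> ({} :: 'v::finite set set)" and \<omega>: "0 < \<omega>"
  shows "real (card {A \<in> selections \<omega>. (i::'v) \<in> A}) = \<omega> * real (card (selections \<omega> :: 'v set set))"
proof -
  let ?m = "CARD('v)"
  obtain B :: "'v set" where B: "real (card B) / real ?m = \<omega>"
    using ne by (auto simp: selections_def)
  define k where "k = card B"
  have k: "\<omega> = real k / real ?m" "0 < k"
    using B \<omega> by (auto simp: k_def intro: Nat.gr0I)
  have sel: "selections \<omega> = {A :: 'v set. card A = k}"
    by (auto simp: selections_def k)
  have card_sel: "card {A :: 'v set. card A = k} = ?m choose k"
    using n_subsets[of "UNIV :: 'v set" k] by simp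
  have "{A \<in> selections \<omega>. i \<in> A} = insert i ` {A. A \<subseteq> - {i} \<and> card A = k - 1}"
  proof (intro equalityI subsetI)
    fix A assume "A \<in> {A \<in> selections \<omega>. i \<in> A}"
    then show "A \<in> insert i ` {A. A \<subseteq> - {i} \<and> card A = k - 1}"
      by (intro image_eqI[of _ _ "A - {i}"]) (auto simp: sel insert_absorb)
  next
    fix A assume "A \<in> insert i ` {A. A \<subseteq> - {i} \<and> card A = k - 1}"
    then obtain C where C: "A = insert i C" "C \<subseteq> - {i}" "card C = k - 1"
      by blast
    then have "i \<notin> C" by blast
    then show "A \<in> {A \<in> selections \<omega>. i \<in> A}"
      unfolding sel using C k(2) by simp
  qed
  moreover have "inj_on (insert i) {A. A \<subseteq> - {i} \<and> card A = k - 1}"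
    by (auto simp: inj_on_def)
  ultimately have "card {A \<in> selections \<omega>. i \<in> A} = (?m - 1) choose (k - 1)"
    using n_subsets[of "- {i}" "k - 1"] by (simp add: card_image Compl_eq_Diff_UNIV)
  moreover have "k * (?m choose k) = ?m * ((?m - 1) choose (k - 1))"
    using k by (intro times_binomial_minus1_eq) auto
  then have "real k * real (?m choose k) = real ?m * real ((?m - 1) choose (k - 1))"
    by (simp only: flip: of_nat_mult)
  ultimately show ?thesis
    using sel card_sel by (simp add: k(1) field_simps)
qed

lemma sum_over_selections:
  assumes "selections \<omega> \<noteq> ({} :: 'v::finite set set)" and "0 < \<omega>"
  shows "(\<Sum>A\<in>selections \<omega>. \<Sum>i\<in>A. c i)
    = \<omega> * real (card (selections \<omega> :: 'v set set)) * (\<Sum>i\<in>UNIV. c (i::'v) :: real)"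
proof -
  have "(\<Sum>A\<in>selections \<omega>. \<Sum>i\<in>A. c i) = (\<Sum>A\<in>selections \<omega>. \<Sum>i\<in>UNIV. if i \<in> A then c i else 0)"
    by (simp add: sum.If_cases)
  also have "\<dots> = (\<Sum>i\<in>UNIV. \<Sum>A\<in>selections \<omega>. if i \<in> A then c i else 0)"
    by (rule sum.swap)
  also have "\<dots> = (\<Sum>i\<in>UNIV. real (card {A \<in> selections \<omega>. i \<in> A}) * c i)"
    by (simp add: sum.If_cases Int_def)
  also have "\<dots> = \<omega> * real (card (selections \<omega> :: 'v set set)) * (\<Sum>i\<in>UNIV. c i)"
    by (simp only: card_selections_containing[OF assms] sum_distrib_left)
  finally show ?thesis .
qed

section \<open>Expectations of extended-real variables\<close>

lemma ereal_expectation_cong: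
  assumes "\<And>w. w \<in> space M \<Longrightarrow> Z w = Z' w"
  shows "ereal_expectation M Z = ereal_expectation M Z'"
  unfolding ereal_expectation_def using assms by (simp cong: nn_integral_cong)

text \<open>The positive part already has infinite integral over \<open>B\<close>, and
  \<open>\<infinity> - b\<close> is \<open>\<infinity>\<close> for every \<open>b\<close>, so the
  negative part cannot interfere.\<close>

lemma (in prob_space) ereal_expectation_infinity:
  assumes B: "B \<in> events" "0 < prob B" and Z: "\<And>w. w \<in> B \<Longrightarrow> Z w = \<infinity>"
  shows "ereal_expectation M Z = \<infinity>"
proof -
  have "(\<infinity>::ennreal) = \<infinity> * emeasure M B"
    using B by (simp add: emeasure_eq_measure ennreal_top_mult)
  also have "\<dots> = (\<integral>\<^sup>+w. \<infinity> * indicator B w \<partial>M)"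
    using B by (simp add: nn_integral_cmult_indicator)
  also have "\<dots> \<le> (\<integral>\<^sup>+w. e2ennreal (Z w) \<partial>M)"
    by (intro nn_integral_mono) (auto simp: Z indicator_def e2ennreal_infty)
  finally show ?thesis
    by (simp add: ereal_expectation_def top_unique)
qed

section \<open>Uniform distribution of the selection histories\<close>

locale node_selection = prob_space M
  for M :: "'w measure" +
  fixes \<omega> :: real and S :: "nat \<Rightarrow> 'w \<Rightarrow> 'v::finite set"
  assumes selection: "random_node_selection M \<omega> S"
begin

abbreviation "K \<equiv> (selections \<omega> :: 'v set set)"

lemma selected: "w \<in> space M \<Longrightarrow> S (Suc t) w \<in> K"
  using selection by (auto simp: random_node_selection_def selections_def)

lemma history_in_histories: "w \<in> space M \<Longrightarrow> history S t w \<in> histories \<omega> t"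
  using selected by (auto simp: histories_def history_def)

lemma K_nonempty: "K \<noteq> {}"
  using selected not_empty by blast

lemma card_K: "0 < card K"
  using K_nonempty by (simp add: card_gt_0_iff)

lemma S_measurable: "random_variable (count_space UNIV) (S (Suc t))"
  using selection by (auto simp: random_node_selection_def indep_vars_def2)

lemma prob_selection:
  assumes "A \<in> K"
  shows "prob (S (Suc t) -` {A} \<inter> space M) = 1 / real (card K)"
proof -
  have "prob (S (Suc t) -` {A} \<inter> space M) = measure (distr M (count_space UNIV) (S (Suc t))) {A}"
    by (simp add: measure_distr[OF S_measurable])
  also have "\<dots> = measure (measure_pmf (pmf_of_set K)) {A}"
    using selection by (simp add: random_node_selection_def selections_def)
  also have "\<dots> = 1 / real (card K)"
    using assms K_nonempty by (simp add: measure_pmf_single)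
  finally show ?thesis .
qed

lemma
  assumes h: "h \<in> histories \<omega> t"
  shows history_event: "history S t -` {h} \<inter> space M \<in> events"
    and prob_history: "prob (history S t -` {h} \<inter> space M) = (1 / real (card K)) ^ t"
proof -
  let ?B = "\<lambda>s. S (Suc s) -` {h ! s} \<inter> space M"
  have len: "length h = t" and hK: "\<And>s. s < t \<Longrightarrow> h ! s \<in> K"
    using h by (auto simp: histories_def)
  have eq: "history S t -` {h} \<inter> space M = {w \<in> space M. \<forall>s<t. S (Suc s) w = h ! s}"
    by (auto simp: history_def list_eq_iff_nth_eq len)
  have "history S t -` {h} \<inter> space M \<in> events \<and>
     prob (history S t -` {h} \<inter> space M) = (1 / real (card K)) ^ t"
  proof (cases "t = 0")
    \<comment> \<open>The product rule and the finite intersection below use a nonempty index set;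
      for \<open>t = 0\<close> the event is the whole space.\<close>
    case True
    then show ?thesis unfolding eq by (simp add: prob_space)
  next
    case False
    have Int: "history S t -` {h} \<inter> space M = (\<Inter>s\<in>{1..t}. S s -` {h ! (s - 1)} \<inter> space M)"
    proof -
      have "(\<forall>s<t. S (Suc s) w = h ! s) \<longleftrightarrow> (\<forall>s\<in>{1..t}. S s w = h ! (s - 1))" for w
        unfolding image_Suc_lessThan[symmetric] by auto
      then show ?thesis using False unfolding eq by auto
    qed
    have "prob (\<Inter>s\<in>{1..t}. S s -` {h ! (s - 1)} \<inter> space M) = (\<Prod>s\<in>{1..t}. prob (S s -` {h ! (s - 1)} \<inter> space M))"
      using selection False
      by (intro indep_varsD[where M' = "\<lambda>_. count_space UNIV" and I = "{1..}"])
         (auto simp: random_node_selection_def)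
    also have "\<dots> = (\<Prod>s\<in>{1..t}. 1 / real (card K))"
    proof (intro prod.cong refl)
      fix s assume s: "s \<in> {1..t}"
      then obtain r where "s = Suc r" "r < t" by (cases s) auto
      then show "prob (S s -` {h ! (s - 1)} \<inter> space M) = 1 / real (card K)"
        using prob_selection[OF hK, of r r] by simp
    qed
    also have "\<dots> = (1 / real (card K)) ^ t" by simp
    finally have "prob (history S t -` {h} \<inter> space M) = (1 / real (card K)) ^ t"
      unfolding Int .
    moreover have "history S t -` {h} \<inter> space M \<in> events"
      unfolding Int
    proof (intro sets.finite_INT)
      fix s assume "s \<in> {1..t}"
      then obtain r where "s = Suc r" by (cases s) auto
      then show "S s -` {h ! (s - 1)} \<inter> space M \<in> events"
        using measurable_sets[OF S_measurable, of "{h ! (s - 1)}" r] by simp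
    qed (use False in auto)
    ultimately show ?thesis by blast
  qed
  then show "history S t -` {h} \<inter> space M \<in> events"
    "prob (history S t -` {h} \<inter> space M) = (1 / real (card K)) ^ t" by auto
qed

lemma prob_history_pos: "h \<in> histories \<omega> t \<Longrightarrow> 0 < prob (history S t -` {h} \<inter> space M)"
  using prob_history card_K by simp

text \<open>An event of positive probability is nonempty; this provides representative
  outcomes.\<close>

lemma history_realized:
  assumes "h \<in> histories \<omega> t"
  obtains w where "w \<in> space M" "history S t w = h"
proof -
  have "history S t -` {h} \<inter> space M \<noteq> {}"
    using prob_history_pos[OF assms] by force
  then show ?thesis using that by blast
qed

text \<open>On \<open>space M\<close> the variable coincides with \<open>Y\<close>, a finite
  combination of indicators of equally likely history events; this stands in for measurability of
  \<open>Z\<close>, which is not at hand.\<close>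

lemma expectation_of_history:
  assumes Z: "\<And>w. w \<in> space M \<Longrightarrow> Z w = ereal (G (history S t w))"
  shows "ereal_expectation M Z = ereal ((\<Sum>h\<in>histories \<omega> t. G h) / real (card K) ^ t)"
proof -
  let ?B = "\<lambda>h. history S t -` {h} \<inter> space M"
  define Y where "Y w = (\<Sum>h\<in>histories \<omega> t. G h * indicator (?B h) w)" for w
  have "Y w = G (history S t w)" if "w \<in> space M" for w
  proof -
    have "Y w = (\<Sum>h\<in>histories \<omega> t. if h = history S t w then G h else 0)"
      unfolding Y_def using that by (intro sum.cong) (auto simp: indicator_def)
    then show ?thesis
      using history_in_histories[OF that] by (simp add: finite_histories)
  qed
  then have "ereal_expectation M Z = ereal_expectation M (\<lambda>w. ereal (Y w))"
    by (intro ereal_expectation_cong) (simp add: Z)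
  moreover have int: "integrable M (\<lambda>w. G h * indicator (?B h) w)" if "h \<in> histories \<omega> t" for h
    using history_event[OF that] by (intro integrable_mult_right) (simp add: emeasure_eq_measure)
  then have "integrable M Y"
    unfolding Y_def by (intro Bochner_Integration.integrable_sum)
  moreover have "expectation Y = (\<Sum>h\<in>histories \<omega> t. G h * prob (?B h))"
    unfolding Y_def using int by (subst Bochner_Integration.integral_sum) auto
  moreover have "\<dots> = (\<Sum>h\<in>histories \<omega> t. G h) / real (card K) ^ t"
    by (simp add: prob_history sum_divide_distrib power_one_over)
  ultimately show ?thesis
    by (simp add: ereal_expectation_eq_integral)
qed

end

section \<open>The two minimization steps\<close>

context mirror_geometry
begin

text \<open>\<open>real_of_ereal\<close> sends infinite values to 0, so this agrees with
  \<open>bregman\<close> only for \<open>v \<in> D\<close> and a finite extension at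
  \<open>u\<close>; these side conditions return wherever the two are exchanged.\<close>

definition breg :: "'a \<Rightarrow> 'a \<Rightarrow> real" where
  "breg u v = real_of_ereal (lsc_extension D \<phi> u) - \<phi> v - gradient \<phi> v \<bullet> (u - v)"

lemma lsc_extension_not_MInf: "v \<in> D \<Longrightarrow> u \<in> closure D \<Longrightarrow> lsc_extension D \<phi> u \<noteq> -\<infinity>"
  using tangent_le_lsc_extension[of v u] by auto

lemma bregman_eq_breg:
  assumes "v \<in> D" "u \<in> closure D" "lsc_extension D \<phi> u \<noteq> \<infinity>"
  shows "bregman D \<phi> u v = ereal (breg u v)"
  using assms lsc_extension_not_MInf[OF assms(1,2)]
  by (cases "lsc_extension D \<phi> u") (auto simp: bregman_def breg_def)

lemma bregman_infinity:
  assumes "v \<notin> D \<or> lsc_extension D \<phi> u = \<infinity>"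
  shows "bregman D \<phi> u v = \<infinity>"
  using assms by (auto simp: bregman_def)

lemma lsc_extension_D [simp]: "u \<in> D \<Longrightarrow> lsc_extension D \<phi> u = ereal (\<phi> u)"
  by (simp add: lsc_extension_def)

end

text \<open>\<open>\<kappa>\<close> is the modulus of strong convexity in the Euclidean norm, later
  \<open>\<alpha> * \<sigma>\<close>; \<open>step_size\<close> is the step condition cleared of its
  denominator.\<close>

locale bpdmm = symmetric_stochastic P + mirror_geometry D \<phi>
  for P :: "real ^ 'v::finite ^ 'v" and D :: "(real ^ 'n::finite) set" and \<phi> +
  fixes E :: "('v \<times> 'v) set" and f :: "'v \<Rightarrow> real ^ 'n \<Rightarrow> ereal" and X :: "(real ^ 'n) set"
    and xstar \<mu>star x0 \<mu>0 :: "'v \<Rightarrow> real ^ 'n" and \<kappa> \<tau> \<rho> \<gamma> \<omega> :: real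
  assumes on_graph: "defined_on_graph E P"
    and irreducible: "irreducible_matrix P" and psd: "positive_semidefinite P"
    and f: "\<And>i. closed_proper_convex (f i)"
    and X: "convex X" "X \<subseteq> closure D"
    and xstar: "\<And>i. xstar i \<in> X" "\<And>i. laplacian P xstar i = 0" "\<And>i. f i (xstar i) \<noteq> \<infinity>"
    and strong: "\<And>u v. u \<in> X \<Longrightarrow> v \<in> X \<Longrightarrow> ereal (\<kappa> / 2 * (norm (u - v))\<^sup>2) \<le> bregman D \<phi> u v"
    and \<kappa>: "0 < \<kappa>" and \<tau>: "0 < \<tau>" and \<rho>: "0 < \<rho>" and \<omega>: "0 < \<omega>"
    and step_size: "\<tau> * (2 - \<omega>) \<le> \<rho> * (\<omega> * \<kappa> - \<gamma>)"
    and x0: "\<And>i. x0 i \<in> X \<inter> D"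
begin

abbreviation "lap \<equiv> laplacian P"
abbreviation "fr i u \<equiv> real_of_ereal (f i u)"
abbreviation "lsc \<equiv> lsc_extension D \<phi>"

lemma X_closure: "u \<in> X \<Longrightarrow> u \<in> closure D"
  using X by blast

lemma lsc_not_MInf: "u \<in> X \<Longrightarrow> lsc u \<noteq> -\<infinity>"
  using lsc_extension_not_MInf x0 X_closure by blast

lemma f_not_MInf: "f i u \<noteq> -\<infinity>"
  using f by (simp add: closed_proper_convex_def)

lemma breg_lower:
  assumes "u \<in> X" "v \<in> X" "v \<in> D" "lsc u \<noteq> \<infinity>"
  shows "\<kappa> / 2 * (norm (u - v))\<^sup>2 \<le> breg u v"
  using strong[OF assms(1,2)] bregman_eq_breg[OF assms(3) X_closure[OF assms(1)] assms(4)] by simp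

text \<open>Strong convexity bounds the symmetrized divergence below by a multiple of the squared
  distance. Two minimizers, each inserted into the optimality inequality of the other, satisfy the
  last hypothesis.\<close>

lemma breg_unique:
  assumes "u \<in> X \<inter> D" "v \<in> X \<inter> D" "breg u v + breg v u \<le> 0"
  shows "u = v"
proof -
  have "\<kappa> / 2 * (norm (u - v))\<^sup>2 \<le> 0"
    using breg_lower[of u v] breg_lower[of v u] assms by (simp add: norm_minus_commute)
  then show ?thesis using \<kappa> by (simp add: mult_le_0_iff)
qed

lemma f_convex:
  assumes "f i u = ereal a" "f i v = ereal b" "0 < s" "s < 1"
  shows "f i (u + s *\<^sub>R (v - u)) \<le> ereal (a + s * (b - a))"
proof -
  have "convex (ereal_epigraph (f i))"
    using f by (simp add: closed_proper_convex_def)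
  moreover have "(u, a) \<in> ereal_epigraph (f i)" "(v, b) \<in> ereal_epigraph (f i)"
    using assms by (auto simp: ereal_epigraph_def)
  ultimately have "(1 - s) *\<^sub>R (u, a) + s *\<^sub>R (v, b) \<in> ereal_epigraph (f i)"
    using assms by (intro convexD_alt) auto
  moreover have "(1 - s) *\<^sub>R (u, a) + s *\<^sub>R (v, b) = (u + s *\<^sub>R (v - u), a + s * (b - a))"
    by (simp add: algebra_simps)
  ultimately show ?thesis by (simp add: ereal_epigraph_def)
qed

lemma P_outside: "j \<notin> neighbors E i \<Longrightarrow> P $ i $ j = 0"
  using on_graph nonneg[of i j] by (force simp: defined_on_graph_def)

lemma neighbor_sum:
  fixes z :: "'v \<Rightarrow> 'a::real_vector"
  shows "(\<Sum>j\<in>neighbors E i. P $ i $ j *\<^sub>R z j) = (\<Sum>j\<in>UNIV. P $ i $ j *\<^sub>R z j)"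
  by (rule sum.mono_neutral_left) (auto simp: P_outside)

text \<open>Unit row sums make the objective \<open>lsc u\<close> plus an affine function
  \<open>G\<close>, so \<open>composite_minimizer\<close> applies with \<open>\<rho> = 1\<close> and
  \<open>G\<close> as its convex part. Rewritten with \<open>breg u y\<close>, its variational
  inequality is the three-point inequality of Bregman projections.\<close>

lemma
  assumes x: "\<And>j. x j \<in> X \<inter> D"
    and min: "is_arg_min (\<lambda>u. \<Sum>j\<in>neighbors E i. ereal (P $ i $ j) * bregman D \<phi> u (x j)) (\<lambda>u. u \<in> X) y"
  shows y_step_domain: "y \<in> X \<inter> D"
    and y_step_inequality: "\<And>u. u \<in> X \<Longrightarrow> lsc u \<noteq> \<infinity> \<Longrightarrow>
      (\<Sum>j\<in>UNIV. P $ i $ j * breg y (x j)) + breg u y \<le> (\<Sum>j\<in>UNIV. P $ i $ j * breg u (x j))"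
proof -
  define G where "G u = (\<Sum>j\<in>UNIV. P $ i $ j * (- \<phi> (x j) - gradient \<phi> (x j) \<bullet> (u - x j)))" for u
  have G: "(\<Sum>j\<in>UNIV. P $ i $ j * breg u (x j)) = real_of_ereal (lsc u) + G u" for u
  proof -
    have "(\<Sum>j\<in>UNIV. P $ i $ j * breg u (x j)) = (\<Sum>j\<in>UNIV. P $ i $ j * real_of_ereal (lsc u)) + G u"
      unfolding G_def sum.distrib[symmetric] by (intro sum.cong) (simp_all add: breg_def algebra_simps)
    then show ?thesis by (simp add: row_sum flip: sum_distrib_right)
  qed
  have obj: "(\<Sum>j\<in>neighbors E i. ereal (P $ i $ j) * bregman D \<phi> u (x j)) = ereal (G u) + ereal 1 * lsc u"
    if u: "u \<in> X" for u
  proof -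
    have *: "(\<Sum>j\<in>neighbors E i. ereal (P $ i $ j) * bregman D \<phi> u (x j)) =
        (\<Sum>j\<in>UNIV. ereal (P $ i $ j) * bregman D \<phi> u (x j))"
      by (rule sum.mono_neutral_left) (auto simp: P_outside)
    show ?thesis
    proof (cases "lsc u = \<infinity>")
      case True
      \<comment> \<open>In \<open>ereal\<close>, \<open>0 * \<infinity> = 0\<close>; a nonzero
        weight is what makes the sum infinite.\<close>
      obtain j where "P $ i $ j \<noteq> 0"
        using row_sum[of i] by (metis sum.neutral zero_neq_one)
      then have "ereal (P $ i $ j) * bregman D \<phi> u (x j) = \<infinity>"
        using nonneg[of i j] by (simp add: bregman_infinity True)
      then have "(\<Sum>j\<in>UNIV. ereal (P $ i $ j) * bregman D \<phi> u (x j)) = \<infinity>"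
        unfolding sum_Pinfty by auto
      then show ?thesis unfolding * by (simp add: True)
    next
      case False
      then obtain l where l: "lsc u = ereal l"
        using lsc_not_MInf[OF u] by (cases "lsc u") auto
      have "(\<Sum>j\<in>UNIV. ereal (P $ i $ j) * bregman D \<phi> u (x j)) = ereal (\<Sum>j\<in>UNIV. P $ i $ j * breg u (x j))"
        using x bregman_eq_breg[OF _ X_closure[OF u] False] by simp
      then show ?thesis unfolding * G by (simp add: l)
    qed
  qed
  have yX: "y \<in> X" using min by (simp add: is_arg_min_def)
  have min': "is_arg_min (\<lambda>u. ereal (G u) + ereal 1 * lsc u) (\<lambda>u. u \<in> X) y"
    using min yX obj unfolding is_arg_min_def by auto
  have aff: "G (u + s *\<^sub>R (v - u)) = G u + s * (G v - G u)" for u v s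
    unfolding G_def sum_subtractf[symmetric] sum_distrib_left sum.distrib[symmetric]
    by (intro sum.cong) (simp_all add: inner_simps algebra_simps)
  \<comment> \<open>Any old iterate can serve as the interior point, since \<open>G\<close> is
    finite everywhere.\<close>
  note cm = composite_minimizer[OF X, where \<rho> = 1 and g = "\<lambda>u. ereal (G u)" and z = "x i" and y = y]
  have yD: "y \<in> D"
    by (rule cm) (use x min' aff in auto)
  then show "y \<in> X \<inter> D" using yX by blast
  fix u assume u: "u \<in> X" "lsc u \<noteq> \<infinity>"
  have "G y - G u \<le> 1 * (gradient \<phi> y \<bullet> (u - y))"
    by (rule cm(3)) (use x min' aff u in auto)
  then show "(\<Sum>j\<in>UNIV. P $ i $ j * breg y (x j)) + breg u y \<le> (\<Sum>j\<in>UNIV. P $ i $ j * breg u (x j))"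
    unfolding G using yD by (simp add: breg_def)
qed

lemma y_step_unique:
  assumes x: "\<And>j. x j \<in> X \<inter> D"
    and "is_arg_min (\<lambda>u. \<Sum>j\<in>neighbors E i. ereal (P $ i $ j) * bregman D \<phi> u (x j)) (\<lambda>u. u \<in> X) y"
    and "is_arg_min (\<lambda>u. \<Sum>j\<in>neighbors E i. ereal (P $ i $ j) * bregman D \<phi> u (x j)) (\<lambda>u. u \<in> X) y'"
  shows "y = y'"
proof (rule breg_unique)
  show y: "y \<in> X \<inter> D" "y' \<in> X \<inter> D"
    using y_step_domain assms by blast+
  show "breg y y' + breg y' y \<le> 0"
    using y_step_inequality[OF x assms(2), of y'] y_step_inequality[OF x assms(3), of y] y by simp
qed

text \<open>The divergence from \<open>y\<close> is \<open>lsc\<close> plus an affine function,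
  which joins \<open>f i\<close> and the linear term in the convex part \<open>g\<close> of
  \<open>composite_minimizer\<close>. The point \<open>z\<close>, interior and with finite
  \<open>f i\<close>, is what rules out a minimizer on the frontier.\<close>

lemma
  assumes y: "y \<in> X \<inter> D" and z: "z \<in> X \<inter> D" "f i z \<noteq> \<infinity>"
    and min: "is_arg_min (\<lambda>u. f i u + ereal (u \<bullet> c) + ereal \<rho> * bregman D \<phi> u y) (\<lambda>u. u \<in> X) x"
  shows x_step_domain: "x \<in> X \<inter> D" "f i x \<noteq> \<infinity>"
    and x_step_inequality: "\<And>u. u \<in> X \<Longrightarrow> lsc u \<noteq> \<infinity> \<Longrightarrow> f i u \<noteq> \<infinity> \<Longrightarrow>
      fr i x + x \<bullet> c + \<rho> * breg x y + \<rho> * breg u x \<le> fr i u + u \<bullet> c + \<rho> * breg u y"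
proof -
  define l where "l u = u \<bullet> c + \<rho> * (- \<phi> y - gradient \<phi> y \<bullet> (u - y))" for u
  have obj: "f i u + ereal (u \<bullet> c) + ereal \<rho> * bregman D \<phi> u y = (f i u + ereal (l u)) + ereal \<rho> * lsc u"
    if u: "u \<in> X" for u
  proof (cases "lsc u = \<infinity>")
    case True
    then show ?thesis using \<rho> by (simp add: bregman_infinity)
  next
    case False
    then obtain m where m: "lsc u = ereal m"
      using lsc_not_MInf[OF u] by (cases "lsc u") auto
    show ?thesis
      using y bregman_eq_breg[OF _ X_closure[OF u] False]
      by (cases "f i u") (auto simp: m l_def breg_def algebra_simps)
  qed
  have xX: "x \<in> X" using min by (simp add: is_arg_min_def)
  have min': "is_arg_min (\<lambda>u. (f i u + ereal (l u)) + ereal \<rho> * lsc u) (\<lambda>u. u \<in> X) x"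
    using min xX obj unfolding is_arg_min_def by auto
  have aff: "l (u + s *\<^sub>R (v - u)) = l u + s * (l v - l u)" for u v s
    by (simp add: l_def inner_simps algebra_simps)
  have conv: "f i (u + s *\<^sub>R (v - u)) + ereal (l (u + s *\<^sub>R (v - u))) \<le> ereal (a + s * (b - a))"
    if ab: "f i u + ereal (l u) = ereal a" "f i v + ereal (l v) = ereal b" and s: "0 < s" "s < 1" for u v s a b
  proof -
    obtain a' b' where ab': "f i u = ereal a'" "f i v = ereal b'" "a = a' + l u" "b = b' + l v"
      using ab by (cases "f i u"; cases "f i v") auto
    have "f i (u + s *\<^sub>R (v - u)) + ereal (l (u + s *\<^sub>R (v - u)))
        \<le> ereal (a' + s * (b' - a')) + ereal (l (u + s *\<^sub>R (v - u)))"
      using f_convex[OF ab'(1,2) s] by (rule add_right_mono)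
    also have "\<dots> = ereal (a + s * (b - a))"
      unfolding aff by (simp add: ab' algebra_simps)
    finally show ?thesis .
  qed
  have nMInf: "f i u + ereal (l u) \<noteq> -\<infinity>" for u
    using f_not_MInf[of i u] by (cases "f i u") auto
  have zfin: "f i z + ereal (l z) \<noteq> \<infinity>"
    using z by (cases "f i z") auto
  note cm = composite_minimizer[OF X \<rho>, where g = "\<lambda>u. f i u + ereal (l u)" and z = z and y = x]
  have xD: "x \<in> D"
    by (rule cm) (use z zfin min' conv nMInf in auto)
  then show "x \<in> X \<inter> D" using xX by blast
  have "f i x + ereal (l x) \<noteq> \<infinity>"
    by (rule cm) (use z zfin min' conv nMInf in auto)
  then show fx: "f i x \<noteq> \<infinity>" by auto
  fix u assume u: "u \<in> X" "lsc u \<noteq> \<infinity>" "f i u \<noteq> \<infinity>"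
  obtain a b where fin: "f i x = ereal a" "f i u = ereal b"
    using fx u(3) f_not_MInf[of i x] f_not_MInf[of i u] by (cases "f i x"; cases "f i u") auto
  have "(a + l x) - (b + l u) \<le> \<rho> * (gradient \<phi> x \<bullet> (u - x))"
    by (rule cm(3)) (use z zfin min' conv nMInf u fin in auto)
  then show "fr i x + x \<bullet> c + \<rho> * breg x y + \<rho> * breg u x \<le> fr i u + u \<bullet> c + \<rho> * breg u y"
    using xD fin by (simp add: breg_def l_def algebra_simps)
qed

lemma x_step_unique:
  assumes y: "y \<in> X \<inter> D" and z: "z \<in> X \<inter> D" "f i z \<noteq> \<infinity>"
    and "is_arg_min (\<lambda>u. f i u + ereal (u \<bullet> c) + ereal \<rho> * bregman D \<phi> u y) (\<lambda>u. u \<in> X) x"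
    and "is_arg_min (\<lambda>u. f i u + ereal (u \<bullet> c) + ereal \<rho> * bregman D \<phi> u y) (\<lambda>u. u \<in> X) x'"
  shows "x = x'"
proof (rule breg_unique)
  note dom = x_step_domain[OF y z assms(4)] x_step_domain[OF y z assms(5)]
  show "x \<in> X \<inter> D" "x' \<in> X \<inter> D" using dom by blast+
  have "\<rho> * (breg x x' + breg x' x) \<le> 0"
    using x_step_inequality[OF y z assms(4), of x'] x_step_inequality[OF y z assms(5), of x] dom
    by (simp add: algebra_simps)
  then show "breg x x' + breg x' x \<le> 0" using \<rho> by (simp add: mult_le_0_iff)
qed

end

section \<open>Descent of the Lyapunov function in one step\<close>

context bpdmm
begin

text \<open>The Lyapunov function in real numbers, with the previous multiplier expressed by the
  current pair. It is the true value only where all \<open>f i\<close> and all Bregman terms are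
  finite.\<close>

definition energy :: "('v \<Rightarrow> real ^ 'n) \<Rightarrow> ('v \<Rightarrow> real ^ 'n) \<Rightarrow> real" where
  "energy x \<mu> =
     (\<Sum>i\<in>UNIV. fr i (x i)) + (\<Sum>i\<in>UNIV. \<mu> i \<bullet> lap x i) - (\<Sum>i\<in>UNIV. fr i (xstar i))
     - \<tau> * (\<Sum>i\<in>UNIV. (norm (lap x i))\<^sup>2)
     + \<omega> / (2 * \<tau>) * (\<Sum>i\<in>UNIV. (norm (\<mu>star i - (\<mu> i - \<tau> *\<^sub>R lap x i)))\<^sup>2)
     + \<rho> * (\<Sum>i\<in>UNIV. breg (xstar i) (x i))"

text \<open>Real form of the residual of a step from \<open>x\<close> with selected set
  \<open>A\<close>; the new point \<open>x'\<close> and the auxiliary \<open>y\<close> are read on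
  \<open>A\<close> only.\<close>

definition decrease ::
  "('v \<Rightarrow> real ^ 'n) \<Rightarrow> 'v set \<Rightarrow> ('v \<Rightarrow> real ^ 'n) \<Rightarrow> ('v \<Rightarrow> real ^ 'n) \<Rightarrow> real" where
  "decrease x A x' y =
     \<omega> * ((\<Sum>i\<in>UNIV. fr i (x i)) + (\<Sum>i\<in>UNIV. \<mu>star i \<bullet> lap x i) - (\<Sum>i\<in>UNIV. fr i (xstar i)))
     + \<rho> * (\<Sum>i\<in>A. breg (x' i) (y i)) + \<gamma> * \<rho> / 2 * (\<Sum>i\<in>UNIV. (norm (lap x i))\<^sup>2)"

lemma sum_update:
  "(\<Sum>i\<in>UNIV. h i (if i \<in> A then a i else b i)) =
   (\<Sum>i\<in>UNIV. h i (b i)) + (\<Sum>i\<in>A. h i (a i) - h i (b i) :: real)" for A :: "'v set"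
proof -
  have "(\<Sum>i\<in>UNIV. h i (if i \<in> A then a i else b i)) =
      (\<Sum>i\<in>UNIV. h i (b i) + (if i \<in> A then h i (a i) - h i (b i) else 0))"
    by (intro sum.cong) auto
  then show ?thesis by (simp add: sum.distrib sum.If_cases)
qed

lemma xstar_const: "xstar i = xstar j"
  using harmonic_constant[OF irreducible] xstar(2) by blast

text \<open>Pure algebra, with no optimality of \<open>xh\<close> and \<open>yh\<close>. In the last
  coefficient \<open>\<tau>\<close> stems from H, \<open>\<omega> * \<tau> / 2\<close> from
  expanding the square of the lagged multiplier and \<open>\<gamma> * \<rho> / 2\<close> from the
  residual.\<close>

lemma energy_difference:
  fixes xh yh x \<mu> :: "'v \<Rightarrow> real ^ 'n"
  defines "x' \<equiv> \<lambda>A i. if i \<in> A then xh i else x i"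
  shows "energy x \<mu> - energy (x' A) (\<lambda>i. \<mu> i + \<tau> *\<^sub>R lap (x' A) i) - decrease x A xh yh =
    - (\<Sum>i\<in>A. fr i (xh i) - fr i (x i) + (xh i - x i) \<bullet> lap \<mu> i
          + \<rho> * (breg (xstar i) (xh i) - breg (xstar i) (x i)) + \<rho> * breg (xh i) (yh i))
    - \<omega> * ((\<Sum>i\<in>UNIV. fr i (x i)) + (\<Sum>i\<in>UNIV. \<mu> i \<bullet> lap x i) - (\<Sum>i\<in>UNIV. fr i (xstar i)))
    - (\<tau> - \<omega> * \<tau> / 2 + \<gamma> * \<rho> / 2) * (\<Sum>i\<in>UNIV. (norm (lap x i))\<^sup>2)"
proof -
  let ?N = "\<Sum>i\<in>UNIV. (norm (lap x i))\<^sup>2"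
  let ?M = "\<Sum>i\<in>UNIV. (norm (\<mu>star i - \<mu> i))\<^sup>2"
  let ?F = "\<Sum>i\<in>UNIV. fr i (x i)" and ?Fs = "\<Sum>i\<in>UNIV. fr i (xstar i)"
  let ?L = "\<Sum>i\<in>UNIV. \<mu> i \<bullet> lap x i" and ?Ls = "\<Sum>i\<in>UNIV. \<mu>star i \<bullet> lap x i"
  let ?B = "\<Sum>i\<in>UNIV. breg (xstar i) (x i)"
  have "(\<Sum>i\<in>UNIV. (norm (\<mu>star i - (\<mu> i - \<tau> *\<^sub>R lap x i)))\<^sup>2) =
      (\<Sum>i\<in>UNIV. (norm (\<mu>star i - \<mu> i))\<^sup>2 + 2 * \<tau> * (\<mu>star i \<bullet> lap x i - \<mu> i \<bullet> lap x i)
        + \<tau>\<^sup>2 * (norm (lap x i))\<^sup>2)"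
    unfolding power2_norm_eq_inner
    by (intro sum.cong refl) (simp add: inner_simps inner_commute power2_eq_square algebra_simps)
  also have "\<dots> = ?M + 2 * \<tau> * (?Ls - ?L) + \<tau>\<^sup>2 * ?N"
    by (simp add: sum.distrib sum_subtractf flip: sum_distrib_left)
  finally have 1: "energy x \<mu> = ?F + ?L - ?Fs - \<tau> * ?N + \<omega> / (2 * \<tau>) * (?M + 2 * \<tau> * (?Ls - ?L) + \<tau>\<^sup>2 * ?N) + \<rho> * ?B"
    by (simp add: energy_def)
  have "(\<Sum>i\<in>UNIV. (\<mu> i + \<tau> *\<^sub>R lap (x' A) i) \<bullet> lap (x' A) i) =
      (\<Sum>i\<in>UNIV. \<mu> i \<bullet> lap (x' A) i) + \<tau> * (\<Sum>i\<in>UNIV. (norm (lap (x' A) i))\<^sup>2)"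
    by (simp add: inner_add_left sum.distrib power2_norm_eq_inner sum_distrib_left)
  moreover have "(\<Sum>i\<in>UNIV. \<mu> i \<bullet> lap (x' A) i) = (\<Sum>i\<in>UNIV. x' A i \<bullet> lap \<mu> i)"
    using laplacian_self_adjoint[of \<mu> "x' A"] by (simp add: inner_commute)
  moreover have "\<dots> = (\<Sum>i\<in>UNIV. x i \<bullet> lap \<mu> i) + (\<Sum>i\<in>A. xh i \<bullet> lap \<mu> i - x i \<bullet> lap \<mu> i)"
    unfolding x'_def by (rule sum_update[where h = "\<lambda>i u. u \<bullet> lap \<mu> i"])
  moreover have "(\<Sum>i\<in>UNIV. x i \<bullet> lap \<mu> i) = ?L"
    using laplacian_self_adjoint[of \<mu> x] by (simp add: inner_commute)
  moreover have "(\<Sum>i\<in>UNIV. fr i (x' A i)) = ?F + (\<Sum>i\<in>A. fr i (xh i) - fr i (x i))"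
    unfolding x'_def by (rule sum_update[where h = fr])
  moreover have "(\<Sum>i\<in>UNIV. breg (xstar i) (x' A i)) =
      ?B + (\<Sum>i\<in>A. breg (xstar i) (xh i) - breg (xstar i) (x i))"
    unfolding x'_def by (rule sum_update[where h = "\<lambda>i. breg (xstar i)"])
  \<comment> \<open>The squared norm of \<open>lap (x' A)\<close> is gone: \<open>\<tau>\<close>
    times it enters with the new multiplier and leaves with the correction in H. The lagged
    multiplier of the new pair is \<open>\<mu>\<close> itself, so only sums over \<open>A\<close>
    remain of the change.\<close>
  ultimately have 2: "energy (x' A) (\<lambda>i. \<mu> i + \<tau> *\<^sub>R lap (x' A) i) =
      ?F + (\<Sum>i\<in>A. fr i (xh i) - fr i (x i)) + ?L + (\<Sum>i\<in>A. xh i \<bullet> lap \<mu> i - x i \<bullet> lap \<mu> i) - ?Fs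
      + \<omega> / (2 * \<tau>) * ?M + \<rho> * (?B + (\<Sum>i\<in>A. breg (xstar i) (xh i) - breg (xstar i) (x i)))"
    by (simp add: energy_def)
  \<comment> \<open>The cross term \<open>\<omega> * (?Ls - ?L)\<close> turns the Lagrangian at
    \<open>\<mu>star\<close> in the residual into the one at \<open>\<mu>\<close>.\<close>
  have 3: "\<omega> / (2 * \<tau>) * (?M + 2 * \<tau> * (?Ls - ?L) + \<tau>\<^sup>2 * ?N)
      = \<omega> / (2 * \<tau>) * ?M + \<omega> * (?Ls - ?L) + \<omega> * \<tau> / 2 * ?N"
    using \<tau> by (simp add: field_simps power2_eq_square)
  have 4: "(\<Sum>i\<in>A. fr i (xh i) - fr i (x i) + (xh i - x i) \<bullet> lap \<mu> i
          + \<rho> * (breg (xstar i) (xh i) - breg (xstar i) (x i)) + \<rho> * breg (xh i) (yh i)) =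
      (\<Sum>i\<in>A. fr i (xh i) - fr i (x i)) + (\<Sum>i\<in>A. xh i \<bullet> lap \<mu> i - x i \<bullet> lap \<mu> i)
      + \<rho> * (\<Sum>i\<in>A. breg (xstar i) (xh i) - breg (xstar i) (x i)) + \<rho> * (\<Sum>i\<in>A. breg (xh i) (yh i))"
    by (simp add: sum.distrib sum_distrib_left inner_diff_left)
  show ?thesis
    unfolding 1 2 3 4 decrease_def by (simp add: algebra_simps)
qed

text \<open>The summand is the one that \<open>energy_difference\<close> collects over
  \<open>A\<close>, here taken over all nodes. The x-step tested at \<open>xstar i\<close> leaves
  \<open>breg (xstar i) (yh i)\<close>, which the y-step at the same point bounds by a weighted
  mean.\<close>

lemma node_inequality:
  fixes x xh yh \<mu> :: "'v \<Rightarrow> real ^ 'n"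
  assumes x: "\<And>i. x i \<in> X \<inter> D" and xs: "\<And>i. lsc (xstar i) \<noteq> \<infinity>"
    and ymin: "\<And>i. is_arg_min (\<lambda>u. \<Sum>j\<in>neighbors E i. ereal (P $ i $ j) * bregman D \<phi> u (x j)) (\<lambda>u. u \<in> X) (yh i)"
    and xmin: "\<And>i. is_arg_min (\<lambda>u. f i u + ereal (u \<bullet> lap \<mu> i) + ereal \<rho> * bregman D \<phi> u (yh i)) (\<lambda>u. u \<in> X) (xh i)"
    and fx: "\<And>i. f i (x i) \<noteq> \<infinity>"
  shows "(\<Sum>i\<in>UNIV. fr i (xh i) - fr i (x i) + (xh i - x i) \<bullet> lap \<mu> i
          + \<rho> * (breg (xstar i) (xh i) - breg (xstar i) (x i)) + \<rho> * breg (xh i) (yh i))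
    \<le> (\<Sum>i\<in>UNIV. fr i (xstar i)) - (\<Sum>i\<in>UNIV. fr i (x i)) - (\<Sum>i\<in>UNIV. \<mu> i \<bullet> lap x i)
      - \<rho> * \<kappa> / 2 * (\<Sum>i\<in>UNIV. (norm (lap x i))\<^sup>2)"
proof -
  let ?c = "\<lambda>i. fr i (xh i) - fr i (x i) + (xh i - x i) \<bullet> lap \<mu> i
          + \<rho> * (breg (xstar i) (xh i) - breg (xstar i) (x i)) + \<rho> * breg (xh i) (yh i)"
  let ?d = "\<lambda>i. fr i (xstar i) - fr i (x i) + (xstar i - x i) \<bullet> lap \<mu> i
          + \<rho> * ((\<Sum>j\<in>UNIV. P $ i $ j * breg (xstar i) (x j)) - (\<Sum>j\<in>UNIV. P $ i $ j * breg (yh i) (x j))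
                 - breg (xstar i) (x i))"
  have y: "yh i \<in> X \<inter> D" for i by (rule y_step_domain[OF x ymin])
  have "?c i \<le> ?d i" for i
  proof -
    have "fr i (xh i) + xh i \<bullet> lap \<mu> i + \<rho> * breg (xh i) (yh i) + \<rho> * breg (xstar i) (xh i)
        \<le> fr i (xstar i) + xstar i \<bullet> lap \<mu> i + \<rho> * breg (xstar i) (yh i)"
      by (rule x_step_inequality[OF y x fx xmin]) (use xstar xs in auto)
    moreover have "\<rho> * breg (xstar i) (yh i) \<le> \<rho> * ((\<Sum>j\<in>UNIV. P $ i $ j * breg (xstar i) (x j))
        - (\<Sum>j\<in>UNIV. P $ i $ j * breg (yh i) (x j)))"
      using y_step_inequality[OF x ymin[of i] xstar(1) xs, of i] \<rho> by (intro mult_left_mono) auto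
    ultimately show ?thesis by (simp add: inner_diff_left algebra_simps)
  qed
  then have "(\<Sum>i\<in>UNIV. ?c i) \<le> (\<Sum>i\<in>UNIV. ?d i)" by (rule sum_mono)
  also have "\<dots> = (\<Sum>i\<in>UNIV. fr i (xstar i)) - (\<Sum>i\<in>UNIV. fr i (x i))
      + ((\<Sum>i\<in>UNIV. xstar i \<bullet> lap \<mu> i) - (\<Sum>i\<in>UNIV. x i \<bullet> lap \<mu> i))
      + \<rho> * ((\<Sum>i\<in>UNIV. \<Sum>j\<in>UNIV. P $ i $ j * breg (xstar i) (x j))
          - (\<Sum>i\<in>UNIV. \<Sum>j\<in>UNIV. P $ i $ j * breg (yh i) (x j)) - (\<Sum>i\<in>UNIV. breg (xstar i) (x i)))"
    by (simp only: sum.distrib sum_subtractf sum_distrib_left[symmetric] inner_diff_left)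
  also have "(\<Sum>i\<in>UNIV. xstar i \<bullet> lap \<mu> i) = 0"
    using laplacian_self_adjoint[of xstar \<mu>] xstar(2) by simp
  also have "(\<Sum>i\<in>UNIV. x i \<bullet> lap \<mu> i) = (\<Sum>i\<in>UNIV. \<mu> i \<bullet> lap x i)"
    using laplacian_self_adjoint[of x \<mu>] by (simp add: inner_commute)
  \<comment> \<open>Consensus exchanges \<open>xstar i\<close> for \<open>xstar j\<close>; what
    \<open>P\<close> multiplies then depends on \<open>j\<close> alone and
    \<open>row_average\<close> applies.\<close>
  also have "(\<Sum>i\<in>UNIV. \<Sum>j\<in>UNIV. P $ i $ j * breg (xstar i) (x j)) = (\<Sum>j\<in>UNIV. breg (xstar j) (x j))"
  proof -
    have "(\<Sum>i\<in>UNIV. \<Sum>j\<in>UNIV. P $ i $ j * breg (xstar i) (x j)) =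
        (\<Sum>i\<in>UNIV. \<Sum>j\<in>UNIV. P $ i $ j * breg (xstar j) (x j))"
      by (intro sum.cong refl arg_cong2[where f = "(*)"] arg_cong2[where f = breg] xstar_const)
    then show ?thesis by (simp only: row_average)
  qed
  finally have *: "(\<Sum>i\<in>UNIV. ?c i) \<le> (\<Sum>i\<in>UNIV. fr i (xstar i)) - (\<Sum>i\<in>UNIV. fr i (x i))
      - (\<Sum>i\<in>UNIV. \<mu> i \<bullet> lap x i) - \<rho> * (\<Sum>i\<in>UNIV. \<Sum>j\<in>UNIV. P $ i $ j * breg (yh i) (x j))"
    by simp
  have "\<kappa> / 2 * (\<Sum>i\<in>UNIV. (norm (lap x i))\<^sup>2)
      \<le> \<kappa> / 2 * (\<Sum>i\<in>UNIV. \<Sum>j\<in>UNIV. P $ i $ j * (norm (yh i - x j))\<^sup>2)"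
    using laplacian_le_spread[OF psd] \<kappa> by (intro mult_left_mono) auto
  also have "\<dots> = (\<Sum>i\<in>UNIV. \<Sum>j\<in>UNIV. P $ i $ j * (\<kappa> / 2 * (norm (yh i - x j))\<^sup>2))"
    by (simp add: sum_distrib_left mult.left_commute)
  also have "\<dots> \<le> (\<Sum>i\<in>UNIV. \<Sum>j\<in>UNIV. P $ i $ j * breg (yh i) (x j))"
    using x y by (intro sum_mono mult_left_mono breg_lower nonneg) auto
  finally have "\<rho> * (\<kappa> / 2 * (\<Sum>i\<in>UNIV. (norm (lap x i))\<^sup>2)) \<le>
      \<rho> * (\<Sum>i\<in>UNIV. \<Sum>j\<in>UNIV. P $ i $ j * breg (yh i) (x j))"
    using \<rho> by (intro mult_left_mono) auto
  with * show ?thesis by simp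
qed

text \<open>Since \<open>xh\<close> and \<open>yh\<close> do not depend on \<open>A\<close>,
  averaging turns the sum over \<open>A\<close> into \<omega> times the sum over all nodes, which
  \<open>node_inequality\<close> bounds.\<close>

lemma averaged_descent:
  fixes x xh yh \<mu> :: "'v \<Rightarrow> real ^ 'n"
  defines "x' \<equiv> \<lambda>A i. if i \<in> A then xh i else x i"
  assumes x: "\<And>i. x i \<in> X \<inter> D" and xs: "\<And>i. lsc (xstar i) \<noteq> \<infinity>"
    and ymin: "\<And>i. is_arg_min (\<lambda>u. \<Sum>j\<in>neighbors E i. ereal (P $ i $ j) * bregman D \<phi> u (x j)) (\<lambda>u. u \<in> X) (yh i)"
    and xmin: "\<And>i. is_arg_min (\<lambda>u. f i u + ereal (u \<bullet> lap \<mu> i) + ereal \<rho> * bregman D \<phi> u (yh i)) (\<lambda>u. u \<in> X) (xh i)"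
    and fx: "\<And>i. f i (x i) \<noteq> \<infinity>"
    and ne: "selections \<omega> \<noteq> ({} :: 'v set set)"
  shows "0 \<le> (\<Sum>A\<in>selections \<omega>. energy x \<mu> - energy (x' A) (\<lambda>i. \<mu> i + \<tau> *\<^sub>R lap (x' A) i) - decrease x A xh yh)"
proof -
  let ?K = "selections \<omega> :: 'v set set"
  let ?N = "\<Sum>i\<in>UNIV. (norm (lap x i))\<^sup>2"
  let ?G = "(\<Sum>i\<in>UNIV. fr i (x i)) + (\<Sum>i\<in>UNIV. \<mu> i \<bullet> lap x i) - (\<Sum>i\<in>UNIV. fr i (xstar i))"
  define c where "c i = fr i (xh i) - fr i (x i) + (xh i - x i) \<bullet> lap \<mu> i
          + \<rho> * (breg (xstar i) (xh i) - breg (xstar i) (x i)) + \<rho> * breg (xh i) (yh i)" for i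
  have "(\<Sum>A\<in>?K. energy x \<mu> - energy (x' A) (\<lambda>i. \<mu> i + \<tau> *\<^sub>R lap (x' A) i) - decrease x A xh yh)
      = (\<Sum>A\<in>?K. - (\<Sum>i\<in>A. c i) - \<omega> * ?G - (\<tau> - \<omega> * \<tau> / 2 + \<gamma> * \<rho> / 2) * ?N)"
    unfolding x'_def c_def energy_difference ..
  also have "\<dots> = - (\<Sum>A\<in>?K. \<Sum>i\<in>A. c i) - real (card ?K) * (\<omega> * ?G)
      - real (card ?K) * ((\<tau> - \<omega> * \<tau> / 2 + \<gamma> * \<rho> / 2) * ?N)"
    by (simp only: sum_subtractf sum_negf sum_constant)
  also have "(\<Sum>A\<in>?K. \<Sum>i\<in>A. c i) = \<omega> * real (card ?K) * (\<Sum>i\<in>UNIV. c i)"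
    by (rule sum_over_selections[OF ne \<omega>])
  also have "- (\<omega> * real (card ?K) * (\<Sum>i\<in>UNIV. c i)) - real (card ?K) * (\<omega> * ?G)
      - real (card ?K) * ((\<tau> - \<omega> * \<tau> / 2 + \<gamma> * \<rho> / 2) * ?N)
      = real (card ?K) * (\<omega> * (- (\<Sum>i\<in>UNIV. c i) - ?G) - (\<tau> - \<omega> * \<tau> / 2 + \<gamma> * \<rho> / 2) * ?N)"
    by (simp add: algebra_simps)
  also have "\<dots> \<ge> 0"
  proof -
    have "\<rho> * \<kappa> / 2 * ?N \<le> - (\<Sum>i\<in>UNIV. c i) - ?G"
      using node_inequality[OF x xs ymin xmin fx] unfolding c_def by simp
    then have "\<omega> * (\<rho> * \<kappa> / 2 * ?N) \<le> \<omega> * (- (\<Sum>i\<in>UNIV. c i) - ?G)"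
      using \<omega> by (intro mult_left_mono) auto
    \<comment> \<open>Half of the step size condition: the dual terms on the left against the gain
      from strong convexity on the right.\<close>
    moreover have "(\<tau> - \<omega> * \<tau> / 2 + \<gamma> * \<rho> / 2) * ?N \<le> (\<omega> * \<rho> * \<kappa> / 2) * ?N"
      using step_size by (intro mult_right_mono sum_nonneg) (auto simp: algebra_simps)
    moreover have "(\<omega> * \<rho> * \<kappa> / 2) * ?N = \<omega> * (\<rho> * \<kappa> / 2 * ?N)" by simp
    ultimately have "0 \<le> \<omega> * (- (\<Sum>i\<in>UNIV. c i) - ?G) - (\<tau> - \<omega> * \<tau> / 2 + \<gamma> * \<rho> / 2) * ?N"
      by linarith
    then show ?thesis by simp
  qed
  finally show ?thesis .
qed

end

section \<open>Runs of the algorithm\<close>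

context bpdmm
begin

abbreviation "run \<equiv> bpdmm_run E P f X D \<phi> \<tau> \<rho> x0 \<mu>0"

lemma
  assumes r: "run S x y \<mu>"
  shows run_0: "x 0 = x0" "\<mu> 0 = \<mu>0"
    and run_unselected: "i \<notin> S (Suc t) \<Longrightarrow> x (Suc t) i = x t i"
    and run_multiplier: "\<mu> (Suc t) i = \<mu> t i + \<tau> *\<^sub>R lap (x (Suc t)) i"
    and run_y: "i \<in> S (Suc t) \<Longrightarrow>
      is_arg_min (\<lambda>u. \<Sum>j\<in>neighbors E i. ereal (P $ i $ j) * bregman D \<phi> u (x t j)) (\<lambda>u. u \<in> X) (y t i)"
    and run_x: "i \<in> S (Suc t) \<Longrightarrow>
      is_arg_min (\<lambda>u. f i u + ereal (u \<bullet> lap (\<mu> t) i) + ereal \<rho> * bregman D \<phi> u (y t i)) (\<lambda>u. u \<in> X)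
        (x (Suc t) i)"
  using r by (simp_all add: bpdmm_run_def neighbor_sum laplacian_def algebra_simps)

lemma run_in_X: "run S x y \<mu> \<Longrightarrow> x t i \<in> X"
proof (induction t)
  case 0
  then show ?case using x0 by (simp add: run_0)
next
  case (Suc t)
  then show ?case
    using run_x[OF Suc.prems, of i t] run_unselected[OF Suc.prems, of i t]
    by (cases "i \<in> S (Suc t)") (auto simp: is_arg_min_def)
qed

text \<open>The terms that are always finite sit in one real summand, so infinities come only from
  \<open>f\<close> or a Bregman term.\<close>

definition lyap :: "('v \<Rightarrow> real ^ 'n) \<Rightarrow> ('v \<Rightarrow> real ^ 'n) \<Rightarrow> ereal" where
  "lyap x \<mu> = (\<Sum>i\<in>UNIV. f i (x i))
     + ereal ((\<Sum>i\<in>UNIV. \<mu> i \<bullet> lap x i) - (\<Sum>i\<in>UNIV. fr i (xstar i))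
         - \<tau> * (\<Sum>i\<in>UNIV. (norm (lap x i))\<^sup>2)
         + \<omega> / (2 * \<tau>) * (\<Sum>i\<in>UNIV. (norm (\<mu>star i - (\<mu> i - \<tau> *\<^sub>R lap x i)))\<^sup>2))
     + ereal \<rho> * (\<Sum>i\<in>UNIV. bregman D \<phi> (xstar i) (x i))"

lemma lagrangian_on_X:
  assumes "\<And>i. z i \<in> X"
  shows "lagrangian P f X z \<nu> = (\<Sum>i\<in>UNIV. f i (z i)) + ereal (\<Sum>i\<in>UNIV. \<nu> i \<bullet> lap z i)"
  using assms by (simp add: lagrangian_def convex_indicator_def QI_stack inner_stack)

lemma sum_f_finite:
  assumes "\<And>i. f i (z i) \<noteq> \<infinity>"
  shows "(\<Sum>i\<in>UNIV. f i (z i)) = ereal (\<Sum>i\<in>UNIV. fr i (z i))"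
proof -
  have "f i (z i) = ereal (fr i (z i))" for i
    using assms[of i] f_not_MInf[of i "z i"] by (cases "f i (z i)") auto
  then have "(\<Sum>i\<in>UNIV. f i (z i)) = (\<Sum>i\<in>UNIV. ereal (fr i (z i)))"
    by (rule sum.cong[OF refl])
  then show ?thesis by simp
qed

lemma lagrangian_saddle: "lagrangian P f X xstar \<mu>star = ereal (\<Sum>i\<in>UNIV. fr i (xstar i))"
  using xstar by (simp add: lagrangian_on_X sum_f_finite)

lemma lyapunov_eq_lyap:
  assumes r: "run S x y \<mu>"
  shows "lyapunov P f X D \<phi> \<tau> \<rho> \<omega> xstar \<mu>star x \<mu> t = lyap (x t) (\<mu> t)"
proof -
  \<comment> \<open>For \<open>t = 0\<close> this is the convention for the multiplier of index -1,
    for a successor the multiplier update solved for the old value.\<close>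
  have "previous_multiplier P \<tau> x \<mu> t = stack (\<lambda>i. \<mu> t i - \<tau> *\<^sub>R lap (x t) i)"
    by (cases t) (simp_all add: previous_multiplier_def QI_stack stack_scaleR stack_diff run_multiplier[OF r])
  then have "lyapunov P f X D \<phi> \<tau> \<rho> \<omega> xstar \<mu>star x \<mu> t =
      ((\<Sum>i\<in>UNIV. f i (x t i)) + ereal (\<Sum>i\<in>UNIV. \<mu> t i \<bullet> lap (x t) i)) - ereal (\<Sum>i\<in>UNIV. fr i (xstar i))
       - ereal (\<tau> * (\<Sum>i\<in>UNIV. (norm (lap (x t) i))\<^sup>2))
       + ereal (\<omega> / (2 * \<tau>) * (\<Sum>i\<in>UNIV. (norm (\<mu>star i - (\<mu> t i - \<tau> *\<^sub>R lap (x t) i)))\<^sup>2))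
       + ereal \<rho> * (\<Sum>i\<in>UNIV. bregman D \<phi> (xstar i) (x t i))"
    by (simp only: lyapunov_def H_fun_def lagrangian_saddle lagrangian_on_X[OF run_in_X[OF r]] QI_stack
        norm_stack stack_diff)
  moreover have "a + ereal b - ereal c - ereal d + ereal e = a + ereal (b - c - d + e)" for a b c d e
    by (cases a) auto
  ultimately show ?thesis by (simp only: lyap_def)
qed

text \<open>In \<open>ereal\<close> a summand \<open>\<infinity>\<close> absorbs everything, even
  \<open>-\<infinity>\<close>, so a total other than \<open>\<infinity>\<close> certifies each term
  separately.\<close>

lemma lyap_not_infinity:
  assumes "lyap x \<mu> \<noteq> \<infinity>"
  shows "f i (x i) \<noteq> \<infinity>" "x i \<in> D" "lsc (xstar i) \<noteq> \<infinity>"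
proof -
  have "(\<Sum>i\<in>UNIV. f i (x i)) \<noteq> \<infinity>" "(\<Sum>i\<in>UNIV. bregman D \<phi> (xstar i) (x i)) \<noteq> \<infinity>"
    using assms \<rho> by (auto simp: lyap_def)
  then have "f i (x i) \<noteq> \<infinity>" "bregman D \<phi> (xstar i) (x i) \<noteq> \<infinity>"
    unfolding sum_Pinfty by auto
  then show "f i (x i) \<noteq> \<infinity>" "x i \<in> D" "lsc (xstar i) \<noteq> \<infinity>"
    using bregman_infinity by blast+
qed

lemma lyap_eq_energy:
  assumes "\<And>i. f i (x i) \<noteq> \<infinity>" "\<And>i. x i \<in> D" "\<And>i. lsc (xstar i) \<noteq> \<infinity>"
  shows "lyap x \<mu> = ereal (energy x \<mu>)"
  using assms xstar(1)
  by (simp add: lyap_def energy_def sum_f_finite bregman_eq_breg X_closure)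

lemma residual_eq_decrease:
  assumes r: "run S x y \<mu>" and "\<And>i. f i (x t i) \<noteq> \<infinity>"
    and "\<And>i. i \<in> S (Suc t) \<Longrightarrow> y t i \<in> D" "\<And>i. i \<in> S (Suc t) \<Longrightarrow> x (Suc t) i \<in> D"
  shows "residual P f X D \<phi> \<rho> \<gamma> \<omega> xstar \<mu>star S x y t =
    ereal (decrease (x t) (S (Suc t)) (x (Suc t)) (y t))"
proof -
  have "(\<Sum>i\<in>S (Suc t). bregman D \<phi> (x (Suc t) i) (y t i)) = ereal (\<Sum>i\<in>S (Suc t). breg (x (Suc t) i) (y t i))"
    using assms by (simp add: bregman_eq_breg X_closure run_in_X)
  then show ?thesis
    by (simp add: residual_def decrease_def lagrangian_saddle lagrangian_on_X[OF run_in_X[OF r]]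
        sum_f_finite assms QI_stack norm_stack)
qed

text \<open>A block inside \<open>D\<close> has infinite \<open>f i\<close>, a block outside
  \<open>D\<close> an infinite Bregman term.\<close>

lemma lyap_infinity_of_empty_domain:
  assumes "\<And>z. z \<in> X \<inter> D \<Longrightarrow> f i z = \<infinity>" and "run S x y \<mu>"
  shows "lyap (x t) (\<mu> t) = \<infinity>"
  using lyap_not_infinity(1,2)[of "x t" "\<mu> t" i] assms(1)[of "x t i"] run_in_X[OF assms(2), of t i]
  by blast

end

section \<open>Runs that stay in the domain of the mirror map\<close>

locale feasible_bpdmm = bpdmm +
  assumes feasible: "\<And>i. \<exists>z \<in> X \<inter> D. f i z \<noteq> \<infinity>"
begin

lemma run_in_D:
  assumes r: "run S x y \<mu>"
  shows "x t i \<in> X \<inter> D"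
proof (induction t arbitrary: i)
  case 0
  then show ?case using x0 by (simp add: run_0[OF r])
next
  case (Suc t)
  show ?case
  proof (cases "i \<in> S (Suc t)")
    case True
    have "y t i \<in> X \<inter> D"
      by (rule y_step_domain[OF Suc run_y[OF r True]])
    then show ?thesis
      using feasible[of i] x_step_domain(1)[OF _ _ _ run_x[OF r True]] by blast
  qed (use Suc run_unselected[OF r] in auto)
qed

lemma run_y_in_D:
  assumes "run S x y \<mu>" "i \<in> S (Suc t)"
  shows "y t i \<in> X \<inter> D"
  by (rule y_step_domain[OF run_in_D[OF assms(1)] run_y[OF assms]])

lemma run_f_finite:
  assumes "run S x y \<mu>" "i \<in> S (Suc t)"
  shows "f i (x (Suc t) i) \<noteq> \<infinity>"
  using feasible[of i] x_step_domain(2)[OF run_y_in_D[OF assms] _ _ run_x[OF assms]] by blast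

text \<open>The two selections may differ at \<open>Suc t\<close>; only a common node is compared.
  This is later applied to outcomes with the same past but different new sets.\<close>

lemma run_step_deterministic:
  assumes r: "run S x y \<mu>" "run S' x' y' \<mu>'" and eq: "x t = x' t" "\<mu> t = \<mu>' t"
    and i: "i \<in> S (Suc t)" "i \<in> S' (Suc t)"
  shows "y t i = y' t i" "x (Suc t) i = x' (Suc t) i"
proof -
  show y: "y t i = y' t i"
    by (rule y_step_unique[OF run_in_D[OF r(1)] run_y[OF r(1) i(1)]]) (use run_y[OF r(2) i(2)] eq in simp)
  obtain z where z: "z \<in> X \<inter> D" "f i z \<noteq> \<infinity>" using feasible by blast
  show "x (Suc t) i = x' (Suc t) i"
    by (rule x_step_unique[OF run_y_in_D[OF r(1) i(1)] z run_x[OF r(1) i(1)]])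
       (use run_x[OF r(2) i(2)] eq y in simp)
qed

lemma run_deterministic:
  assumes r: "run S x y \<mu>" "run S' x' y' \<mu>'" and "\<And>s. s < t \<Longrightarrow> S (Suc s) = S' (Suc s)"
  shows "x t = x' t \<and> \<mu> t = \<mu>' t"
  using assms(3)
proof (induction t)
  case 0
  then show ?case by (simp add: run_0[OF r(1)] run_0[OF r(2)])
next
  case (Suc t)
  then have eq: "x t = x' t" "\<mu> t = \<mu>' t" and S: "S (Suc t) = S' (Suc t)" by auto
  have x: "x (Suc t) = x' (Suc t)"
  proof
    fix i
    show "x (Suc t) i = x' (Suc t) i"
      using run_step_deterministic(2)[OF r eq] run_unselected[OF r(1)] run_unselected[OF r(2)] eq S
      by (cases "i \<in> S (Suc t)") auto
  qed
  moreover have "\<mu> (Suc t) = \<mu>' (Suc t)"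
    by (rule ext) (simp add: run_multiplier[OF r(1)] run_multiplier[OF r(2)] x eq)
  ultimately show ?case by blast
qed

end

section \<open>Expected descent over the selection histories\<close>

locale stochastic_bpdmm = bpdmm P D \<phi> E f X xstar \<mu>star x0 \<mu>0 \<kappa> \<tau> \<rho> \<gamma> \<omega> + node_selection M \<omega> S
  for P :: "real ^ 'v::finite ^ 'v" and D :: "(real ^ 'n::finite) set" and \<phi> E f X xstar \<mu>star x0 \<mu>0
    and \<kappa> \<tau> \<rho> \<gamma> \<omega> :: real and M :: "'w measure" and S +
  fixes x y \<mu> :: "'w \<Rightarrow> nat \<Rightarrow> 'v \<Rightarrow> real ^ 'n"
  assumes runs: "\<And>w. w \<in> space M \<Longrightarrow> run (\<lambda>s. S s w) (x w) (y w) (\<mu> w)"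

locale feasible_stochastic_bpdmm = stochastic_bpdmm + feasible_bpdmm
begin

lemma history_determines:
  assumes "w \<in> space M" "w' \<in> space M" "history S t w = history S t w'"
  shows "x w t = x w' t" "\<mu> w t = \<mu> w' t"
proof -
  have "S (Suc s) w = S (Suc s) w'" if "s < t" for s
    using arg_cong[OF assms(3), of "\<lambda>h. h ! s"] that by (simp add: history_def)
  then show "x w t = x w' t" "\<mu> w t = \<mu> w' t"
    using run_deterministic[OF runs[OF assms(1)] runs[OF assms(2)], of t] by auto
qed

text \<open>Outcomes with equal history share their iterates, so each history may be evaluated at
  one chosen outcome \<open>rep\<close>. The inequality then holds past by past, after summing over
  the next set.\<close>

lemma expected_descent_real:
  assumes fin: "\<And>w. w \<in> space M \<Longrightarrow> lyap (x w t) (\<mu> w t) \<noteq> \<infinity>"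
  shows "ereal_expectation M (\<lambda>w. residual P f X D \<phi> \<rho> \<gamma> \<omega> xstar \<mu>star (\<lambda>s. S s w) (x w) (y w) t)
    \<le> ereal_expectation M (\<lambda>w. lyap (x w t) (\<mu> w t))
      - ereal_expectation M (\<lambda>w. lyap (x w (Suc t)) (\<mu> w (Suc t)))"
proof -
  define rep where "rep s h = (SOME w. w \<in> space M \<and> history S s w = h)" for s h
  have rep: "rep s h \<in> space M" "history S s (rep s h) = h" if "h \<in> histories \<omega> s" for s h
  proof -
    have "\<exists>w. w \<in> space M \<and> history S s w = h"
      using history_realized[OF that] by blast
    then have "rep s h \<in> space M \<and> history S s (rep s h) = h"
      unfolding rep_def by (rule someI_ex)
    then show "rep s h \<in> space M" "history S s (rep s h) = h" by auto
  qed
  have rep_history: "rep s (history S s w) \<in> space M"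
    "x (rep s (history S s w)) s = x w s" "\<mu> (rep s (history S s w)) s = \<mu> w s"
    if "w \<in> space M" for s w
    using rep[OF history_in_histories[OF that]] history_determines[OF _ that] by blast+
  have f_t: "f i (x w t i) \<noteq> \<infinity>" and xs: "lsc (xstar i) \<noteq> \<infinity>" if "w \<in> space M" for w i
    using lyap_not_infinity[OF fin[OF that]] by auto
  have xD: "x w s i \<in> X \<inter> D" if "w \<in> space M" for w s i
    by (rule run_in_D[OF runs[OF that]])
  \<comment> \<open>A selected block is finite as a minimizer, an unselected one inherits
    finiteness.\<close>
  have f_Suc: "f i (x w (Suc t) i) \<noteq> \<infinity>" if "w \<in> space M" for w i
    using run_f_finite[OF runs[OF that], of i t] run_unselected[OF runs[OF that], of i t] f_t[OF that]
    by metis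
  define G0 where "G0 h = energy (x (rep t h) t) (\<mu> (rep t h) t)" for h
  define G1 where "G1 h = energy (x (rep (Suc t) h) (Suc t)) (\<mu> (rep (Suc t) h) (Suc t))" for h
  define GR where "GR h = (let w = rep (Suc t) h in
    decrease (x w t) (S (Suc t) w) (x w (Suc t)) (y w t))" for h
  let ?k = "real (card K)"
  have E0: "ereal_expectation M (\<lambda>w. lyap (x w t) (\<mu> w t)) = ereal ((\<Sum>h\<in>histories \<omega> t. G0 h) / ?k ^ t)"
  proof (rule expectation_of_history)
    fix w assume w: "w \<in> space M"
    have "lyap (x w t) (\<mu> w t) = ereal (energy (x w t) (\<mu> w t))"
      by (rule lyap_eq_energy) (use f_t[OF w] xs[OF w] xD[OF w] in auto)
    then show "lyap (x w t) (\<mu> w t) = ereal (G0 (history S t w))"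
      by (simp add: G0_def rep_history[OF w])
  qed
  have E1: "ereal_expectation M (\<lambda>w. lyap (x w (Suc t)) (\<mu> w (Suc t))) =
      ereal ((\<Sum>h\<in>histories \<omega> (Suc t). G1 h) / ?k ^ Suc t)"
  proof (rule expectation_of_history)
    fix w assume w: "w \<in> space M"
    have "lyap (x w (Suc t)) (\<mu> w (Suc t)) = ereal (energy (x w (Suc t)) (\<mu> w (Suc t)))"
      by (rule lyap_eq_energy) (use f_Suc[OF w] xs[OF w] xD[OF w] in auto)
    then show "lyap (x w (Suc t)) (\<mu> w (Suc t)) = ereal (G1 (history S (Suc t) w))"
      by (simp add: G1_def rep_history[OF w])
  qed
  have same_step: "S (Suc t) w = S (Suc t) w'" "x w t = x w' t" "\<mu> w t = \<mu> w' t"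
    if "w \<in> space M" "w' \<in> space M" "history S (Suc t) w = history S (Suc t) w'" for w w'
    using that history_determines[of w w' t] by (auto simp: history_Suc)
  have ER: "ereal_expectation M (\<lambda>w. residual P f X D \<phi> \<rho> \<gamma> \<omega> xstar \<mu>star (\<lambda>s. S s w) (x w) (y w) t) =
      ereal ((\<Sum>h\<in>histories \<omega> (Suc t). GR h) / ?k ^ Suc t)"
  proof (rule expectation_of_history)
    fix w assume w: "w \<in> space M"
    have "residual P f X D \<phi> \<rho> \<gamma> \<omega> xstar \<mu>star (\<lambda>s. S s w) (x w) (y w) t =
        ereal (decrease (x w t) (S (Suc t) w) (x w (Suc t)) (y w t))"
      by (rule residual_eq_decrease[OF runs[OF w]])
         (use f_t[OF w] xD[OF w] run_y_in_D[OF runs[OF w]] in auto)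
    moreover have "decrease (x w t) (S (Suc t) w) (x w (Suc t)) (y w t) = GR (history S (Suc t) w)"
    proof -
      let ?w = "rep (Suc t) (history S (Suc t) w)"
      have w': "?w \<in> space M" "history S (Suc t) ?w = history S (Suc t) w"
        using rep history_in_histories[OF w] by blast+
      note same = same_step[OF w'(1) w w'(2)]
      \<comment> \<open>\<open>y\<close> is determined at selected nodes only, which is all that
        \<open>decrease\<close> reads.\<close>
      have "y ?w t i = y w t i" if "i \<in> S (Suc t) w" for i
        using run_step_deterministic(1)[OF runs[OF w'(1)] runs[OF w]] same that by simp
      then show ?thesis
        by (simp add: GR_def decrease_def Let_def same rep_history[OF w])
    qed
    ultimately show "residual P f X D \<phi> \<rho> \<gamma> \<omega> xstar \<mu>star (\<lambda>s. S s w) (x w) (y w) t =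
        ereal (GR (history S (Suc t) w))" by simp
  qed
  have step: "0 \<le> (\<Sum>A\<in>K. G0 h - G1 (h @ [A]) - GR (h @ [A]))" if h: "h \<in> histories \<omega> t" for h
  proof -
    define w where "w A = rep (Suc t) (h @ [A])" for A
    have hA: "h @ [A] \<in> histories \<omega> (Suc t)" if "A \<in> K" for A
      using h that by (auto simp: histories_def)
    have w: "w A \<in> space M" "history S t (w A) = h" "S (Suc t) (w A) = A" if "A \<in> K" for A
      using rep[OF hA[OF that]] by (auto simp: w_def history_Suc)
    let ?w = "rep t h"
    have wt: "x (w A) t = x ?w t" "\<mu> (w A) t = \<mu> ?w t" if "A \<in> K" for A
      using history_determines[of "w A" ?w t] w[OF that] rep[OF h] by simp_all
    \<comment> \<open>Every node lies in the positive fraction \<open>\<omega>\<close> of the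
      selections, so some extension of the past selects \<open>i\<close>; an outcome with this
      extension shows the update that node \<open>i\<close> would make.\<close>
    define B where "B i = (SOME A. A \<in> K \<and> i \<in> A)" for i
    have B: "B i \<in> K" "i \<in> B i" for i
    proof -
      have "0 < real (card {A \<in> K. i \<in> A})"
        unfolding card_selections_containing[OF K_nonempty \<omega>] using \<omega> card_K by simp
      then have "\<exists>A. A \<in> K \<and> i \<in> A" by (auto simp: card_gt_0_iff)
      then have "B i \<in> K \<and> i \<in> B i" unfolding B_def by (rule someI_ex)
      then show "B i \<in> K" "i \<in> B i" by auto
    qed
    define xh where "xh i = x (w (B i)) (Suc t) i" for i
    define yh where "yh i = y (w (B i)) t i" for i
    define x' where "x' A i = (if i \<in> A then xh i else x ?w t i)" for A i
    \<comment> \<open>The choice of \<open>B i\<close> is immaterial: by uniqueness, any set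
      containing \<open>i\<close> yields the same update.\<close>
    have sel: "xh i = x (w A) (Suc t) i" "yh i = y (w A) t i" if "A \<in> K" "i \<in> A" for A i
      using run_step_deterministic[OF runs[OF w(1)[OF B(1)]] runs[OF w(1)[OF that(1)]], where t = t and i = i]
        wt[OF that(1)] wt[OF B(1)] w(3)[OF that(1)] w(3)[OF B(1)] B(2) that
      by (simp_all add: xh_def yh_def)
    have x_new: "x (w A) (Suc t) = x' A" if "A \<in> K" for A
    proof
      fix i show "x (w A) (Suc t) i = x' A i"
        using sel[OF that, of i] run_unselected[OF runs[OF w(1)[OF that]], of i t] w(3)[OF that] wt(1)[OF that]
        by (auto simp: x'_def)
    qed
    have mu_new: "\<mu> (w A) (Suc t) = (\<lambda>i. \<mu> ?w t i + \<tau> *\<^sub>R lap (x' A) i)" if "A \<in> K" for A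
      by (rule ext) (simp add: run_multiplier[OF runs[OF w(1)[OF that]]] x_new[OF that] wt[OF that])
    have "0 \<le> (\<Sum>A\<in>K. energy (x ?w t) (\<mu> ?w t) - energy (x' A) (\<lambda>i. \<mu> ?w t i + \<tau> *\<^sub>R lap (x' A) i)
        - decrease (x ?w t) A xh yh)"
      unfolding x'_def
    proof (rule averaged_descent)
      fix i
      note r = runs[OF w(1)[OF B(1)[of i]]]
      have i: "i \<in> S (Suc t) (w (B i))" using w(3) B by simp
      show "is_arg_min (\<lambda>u. \<Sum>j\<in>neighbors E i. ereal (P $ i $ j) * bregman D \<phi> u (x ?w t j)) (\<lambda>u. u \<in> X) (yh i)"
        using run_y[OF r i] by (simp add: wt[OF B(1)] yh_def)
      show "is_arg_min (\<lambda>u. f i u + ereal (u \<bullet> lap (\<mu> ?w t) i) + ereal \<rho> * bregman D \<phi> u (yh i)) (\<lambda>u. u \<in> X) (xh i)"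
        using run_x[OF r i] by (simp add: wt[OF B(1)] yh_def xh_def)
      show "x ?w t i \<in> X \<inter> D" "f i (x ?w t i) \<noteq> \<infinity>" "lsc (xstar i) \<noteq> \<infinity>"
        using xD f_t xs rep(1)[OF h] by blast+
    qed (rule K_nonempty)
    also have "\<dots> = (\<Sum>A\<in>K. G0 h - G1 (h @ [A]) - GR (h @ [A]))"
    proof (rule sum.cong[OF refl])
      fix A assume A: "A \<in> K"
      have "G1 (h @ [A]) = energy (x' A) (\<lambda>i. \<mu> ?w t i + \<tau> *\<^sub>R lap (x' A) i)"
        using x_new[OF A] mu_new[OF A] by (simp add: G1_def w_def)
      moreover have "GR (h @ [A]) = decrease (x ?w t) A xh yh"
      proof -
        have "GR (h @ [A]) = decrease (x ?w t) A (x (w A) (Suc t)) (y (w A) t)"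
          using w(3)[OF A] wt(1)[OF A] by (simp add: GR_def Let_def flip: w_def)
        then show ?thesis using sel[OF A] by (simp add: decrease_def)
      qed
      ultimately show "energy (x ?w t) (\<mu> ?w t) - energy (x' A) (\<lambda>i. \<mu> ?w t i + \<tau> *\<^sub>R lap (x' A) i)
          - decrease (x ?w t) A xh yh = G0 h - G1 (h @ [A]) - GR (h @ [A])"
        by (simp add: G0_def)
    qed
    finally show ?thesis .
  qed
  have "0 \<le> (\<Sum>h\<in>histories \<omega> t. \<Sum>A\<in>K. G0 h - G1 (h @ [A]) - GR (h @ [A]))"
    by (rule sum_nonneg) (rule step)
  \<comment> \<open>\<open>G0\<close> does not depend on \<open>A\<close>, hence the factor
    \<open>?k\<close>, which later reduces \<open>?k ^ Suc t\<close> to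
    \<open>?k ^ t\<close>.\<close>
  also have "\<dots> = ?k * (\<Sum>h\<in>histories \<omega> t. G0 h) - (\<Sum>h\<in>histories \<omega> (Suc t). G1 h)
      - (\<Sum>h\<in>histories \<omega> (Suc t). GR h)"
    by (simp add: sum_histories_Suc sum_subtractf sum_distrib_left)
  finally have "(\<Sum>h\<in>histories \<omega> (Suc t). GR h) / ?k ^ Suc t
      \<le> (?k * (\<Sum>h\<in>histories \<omega> t. G0 h) - (\<Sum>h\<in>histories \<omega> (Suc t). G1 h)) / ?k ^ Suc t"
    by (intro divide_right_mono) auto
  also have "\<dots> = (\<Sum>h\<in>histories \<omega> t. G0 h) / ?k ^ t - (\<Sum>h\<in>histories \<omega> (Suc t). G1 h) / ?k ^ Suc t"
    using card_K K_nonempty by (simp add: diff_divide_distrib)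
  finally show ?thesis
    unfolding E0 E1 ER by simp
qed

text \<open>\<open>lyap\<close> is constant on the event of a history, and this event has positive
  probability.\<close>

lemma expected_descent_infinite:
  assumes w: "w \<in> space M" and inf: "lyap (x w t) (\<mu> w t) = \<infinity>"
  shows "ereal_expectation M (\<lambda>w. lyap (x w t) (\<mu> w t)) = \<infinity>"
proof (rule ereal_expectation_infinity)
  let ?h = "history S t w"
  show "history S t -` {?h} \<inter> space M \<in> events" "0 < prob (history S t -` {?h} \<inter> space M)"
    using history_event prob_history_pos history_in_histories[OF w] by blast+
  fix w' assume "w' \<in> history S t -` {?h} \<inter> space M"
  then show "lyap (x w' t) (\<mu> w' t) = \<infinity>"
    using history_determines[of w' w t] w inf by simp
qed

end

text \<open>Feasibility alone does not make every value finite: an initial block may have infinite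
  \<open>f i\<close> and keeps it until its node is selected. Then the first expectation is infinite
  and the bound is trivial.\<close>

lemma (in stochastic_bpdmm) expected_descent:
  "ereal_expectation M (\<lambda>w. residual P f X D \<phi> \<rho> \<gamma> \<omega> xstar \<mu>star (\<lambda>s. S s w) (x w) (y w) t)
    \<le> ereal_expectation M (\<lambda>w. lyap (x w t) (\<mu> w t))
      - ereal_expectation M (\<lambda>w. lyap (x w (Suc t)) (\<mu> w (Suc t)))"
proof (cases "\<forall>i. \<exists>z \<in> X \<inter> D. f i z \<noteq> \<infinity>")
  case True
  then interpret feasible_stochastic_bpdmm
    by unfold_locales auto
  show ?thesis
  proof (cases "\<exists>w \<in> space M. lyap (x w t) (\<mu> w t) = \<infinity>")
    case True
    then have "ereal_expectation M (\<lambda>w. lyap (x w t) (\<mu> w t)) = \<infinity>"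
      using expected_descent_infinite by blast
    then show ?thesis by simp
  next
    case False
    then show ?thesis by (intro expected_descent_real) blast
  qed
next
  case False
  then obtain i where "\<And>z. z \<in> X \<inter> D \<Longrightarrow> f i z = \<infinity>" by blast
  then have "lyap (x w t) (\<mu> w t) = \<infinity>" if "w \<in> space M" for w
    using lyap_infinity_of_empty_domain runs[OF that] by blast
  then have "ereal_expectation M (\<lambda>w. lyap (x w t) (\<mu> w t)) = \<infinity>"
    by (intro ereal_expectation_infinity[of "space M"]) (auto simp: prob_space)
  then show ?thesis by simp
qed

section \<open>The monotonicity relation\<close>

theorem theorem1:
  fixes E :: "('v::finite \<times> 'v) set"
    and P :: "real ^ 'v ^ 'v"
    and f :: "'v \<Rightarrow> real ^ 'n \<Rightarrow> ereal"
    and X D :: "(real ^ 'n) set"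
    and \<phi> :: "real ^ 'n \<Rightarrow> real"
    and xstar \<mu>star x0 \<mu>0 :: "'v \<Rightarrow> real ^ 'n"
    and p :: ereal
    and \<alpha> \<tau> \<rho> \<gamma> \<omega> \<sigma> :: real
    and M :: "'w measure"
    and S :: "nat \<Rightarrow> 'w \<Rightarrow> 'v set"
    and x y \<mu> :: "'w \<Rightarrow> nat \<Rightarrow> 'v \<Rightarrow> real ^ 'n"
    and t :: nat
  assumes graph: "undirected_connected_graph E" "defined_on_graph E P"
    and f: "\<And>i. closed_proper_convex (f i)"
    and X: "closed X" "convex X"
    and saddle_point:
      "\<And>i. xstar i \<in> X"
      "\<And>i. (\<Sum>j\<in>UNIV. P $ i $ j *\<^sub>R xstar j) = xstar i"
      "\<And>i. - \<mu>star i + (\<Sum>j\<in>UNIV. P $ i $ j *\<^sub>R \<mu>star j)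
              \<in> subdifferential (\<lambda>u. f i u + convex_indicator X u) (xstar i)"
    and D: "open D" "convex D" "X \<subseteq> closure D"
    and mirror: "mirror_map D \<phi>"
    and strong_convexity:
      "1 \<le> p" "0 < \<alpha>"
      "\<And>u v. u \<in> X \<Longrightarrow> v \<in> X \<Longrightarrow> bregman D \<phi> u v \<ge> ereal (\<alpha> / 2 * (lp_norm p (u - v))\<^sup>2)"
    and P: "transpose P = P" "stochastic_matrix P" "irreducible_matrix P"
      "positive_semidefinite P"
    and M: "prob_space M"
    and \<omega>: "0 < \<omega>" "\<omega> < 1"
    and S: "random_node_selection M \<omega> S"
    and params: "0 < \<tau>" "0 < \<rho>"
    and init: "\<And>i. x0 i \<in> X \<inter> D"
    and run: "\<And>w. w \<in> space M \<Longrightarrow>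
      bpdmm_run E P f X D \<phi> \<tau> \<rho> x0 \<mu>0 (\<lambda>s. S s w) (x w) (y w) (\<mu> w)"
    and \<sigma>: "\<sigma> = min 1 (real CARD('n) powr (real_of_ereal (2 / p) - 1))"
    and step: "\<tau> \<le> \<rho> * (\<omega> * \<alpha> * \<sigma> - \<gamma>) / (2 - \<omega>)" "0 < \<gamma>" "\<gamma> < \<omega> * \<alpha> * \<sigma>"
  shows
    "ereal_expectation M (\<lambda>w. lyapunov P f X D \<phi> \<tau> \<rho> \<omega> xstar \<mu>star (x w) (\<mu> w) t)
       - ereal_expectation M (\<lambda>w. lyapunov P f X D \<phi> \<tau> \<rho> \<omega> xstar \<mu>star (x w) (\<mu> w) (t + 1))
     \<ge> ereal_expectation M
         (\<lambda>w. residual P f X D \<phi> \<rho> \<gamma> \<omega> xstar \<mu>star (\<lambda>s. S s w) (x w) (y w) t)"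
proof -
  have n: "0 < \<sigma>"
    by (simp add: \<sigma>)
  interpret mirror_geometry D \<phi>
    using D mirror by unfold_locales auto
  interpret symmetric_stochastic P
    using P by unfold_locales auto
  have strong: "ereal (\<alpha> * \<sigma> / 2 * (norm (u - v))\<^sup>2) \<le> bregman D \<phi> u v" if "u \<in> X" "v \<in> X" for u v
  proof -
    have "\<alpha> / 2 * (\<sigma> * (norm (u - v))\<^sup>2) \<le> \<alpha> / 2 * (lp_norm p (u - v))\<^sup>2"
      using lp_norm_comparison[OF strong_convexity(1) \<sigma>] strong_convexity(2) by (intro mult_left_mono) auto
    then have "ereal (\<alpha> * \<sigma> / 2 * (norm (u - v))\<^sup>2) \<le> ereal (\<alpha> / 2 * (lp_norm p (u - v))\<^sup>2)"
      by simp
    also have "\<dots> \<le> bregman D \<phi> u v"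
      using strong_convexity(3) that by blast
    finally show ?thesis .
  qed
  \<comment> \<open>The subdifferential is empty where the function is infinite, so the saddle point
    inclusion yields finiteness.\<close>
  have f_xstar: "f i (xstar i) \<noteq> \<infinity>" for i
    using saddle_point(3)[of i] by (auto simp: subdifferential_def)
  have step': "\<tau> * (2 - \<omega>) \<le> \<rho> * (\<omega> * (\<alpha> * \<sigma>) - \<gamma>)"
    using step(1) \<omega> by (simp add: pos_le_divide_eq mult.assoc)
  interpret prob_space M by (rule M)
  interpret stochastic_bpdmm P D \<phi> E f X xstar \<mu>star x0 \<mu>0 "\<alpha> * \<sigma>" \<tau> \<rho> \<gamma> \<omega> M S x y \<mu>
    using graph f X D saddle_point(1,2) f_xstar strong n strong_convexity(2) params \<omega> step' init P S run
    by unfold_locales (auto simp: laplacian_def)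
  have "ereal_expectation M (\<lambda>w. lyapunov P f X D \<phi> \<tau> \<rho> \<omega> xstar \<mu>star (x w) (\<mu> w) s) =
      ereal_expectation M (\<lambda>w. lyap (x w s) (\<mu> w s))" for s
    by (intro ereal_expectation_cong lyapunov_eq_lyap[OF runs])
  then show ?thesis
    using expected_descent[of t] by simp
qed

end
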